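(* (Gelfand–Naimark theorem) For any $\mathbb{H}$-$B^*$-algebra $A$, there exist a Hilbert $\mathbb{H}$-bimodule $H$ and an isometric $\mathbb{H}$-$*$-homomorphism from $A$ to $\mathcal{L}_{\mathbb{H},r}(H)$.
   Context: $\mathbb{H}$ denotes the real quaternions with conjugation $^*$ and the Euclidean norm; $\mathbb{R}$ is identified with its center. An $\mathbb{H}$-vector space is a unital $\mathbb{H}$-bimodule $X$ with $rx=xr$ for $r\in\mathbb{R}$; an $\mathbb{H}$-normed space is an $\mathbb{H}$-vector space with a norm satisfying $\|\alpha x\beta\|\le\|\alpha\|\|x\|\|\beta\|$. An $\mathbb{H}$-algebra is an $\mathbb{H}$-vector space $A$ that is also an $\mathbb{R}$-algebra (for the induced real vector space structure; no unit required) with $(\gamma a)b=\gamma(ab)$, $(a\gamma)b=a(\gamma b)$, $(ab)\gamma=a(b\gamma)$ for $a,b\in A$, $\gamma\in\mathbb{H}$. An $\mathbb{H}$-involution on $A$ is a (real) involution with $(\alpha b)^*=b^*\alpha^*$ and $(b\alpha)^*=\alpha^*b^*$ for $\alpha\in\mathbb{H}$, $b\in A$. An $\mathbb{H}$-$B^*$-algebra is an $\mathbb{H}$-algebra with $\mathbb{H}$-involution and a norm making it a complete $\mathbb{H}$-normed space with $\|ab\|\le\|a\|\|b\|$ and $\|a^*a\|=\|a\|^2$. An $\mathbb{H}$-$*$-homomorphism is an $\mathbb{H}$-bimodule map that is multiplicative and $*$-preserving. An $\mathbb{H}$-valued inner product on a right $\mathbb{H}$-module $Y$ is a map $\langle\cdot,\cdot\rangle:Y\times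 Y\to\mathbb{H}$ with $\langle x,y+z\beta\rangle=\langle x,y\rangle+\langle x,z\rangle\beta$, $\langle y,x\rangle=\langle x,y\rangle^*$, $\langle x,x\rangle\ge0$, and $\langle x,x\rangle=0$ implies $x=0$. A Hilbert $\mathbb{H}$-bimodule is an $\mathbb{H}$-vector space $Y$ with an $\mathbb{H}$-valued inner product such that $\langle\alpha x,y\rangle=\langle x,\alpha^*y\rangle$ for $x,y\in Y$, $\alpha\in\mathbb{H}$, and which is complete under $\|y\|=\sqrt{\|\langle y,y\rangle\|}$. $\mathcal{L}_{\mathbb{H},r}(Y)$ is the algebra of all adjointable right $\mathbb{H}$-module maps on $Y$, with operator norm and adjoint as involution. It is an $\mathbb{H}$-$B^*$-algebra with scalar multiplications $\alpha T=\Theta(\alpha)T$, $T\alpha=T\Theta(\alpha)$, where $\Theta(\alpha)$ is left multiplication by $\alpha$ on $Y$. *)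

theory Defs
  imports "HOL-Analysis.Analysis" "HOL-Library.Function_Algebras"
begin

section \<open>The real quaternions\<close>

text \<open>\<open>Quat a b c d\<close> is $a + bi + cj + dk$.\<close>

datatype quat = Quat (qRe: real) (qI: real) (qJ: real) (qK: real)

lemma quat_eq_iff: "p = q \<longleftrightarrow> qRe p = qRe q \<and> qI p = qI q \<and> qJ p = qJ q \<and> qK p = qK q"
  by (cases p; cases q) simp

instantiation quat :: ring_1
begin
definition "0 = Quat 0 0 0 0"
definition "1 = Quat 1 0 0 0"
definition "p + q = Quat (qRe p + qRe q) (qI p + qI q) (qJ p + qJ q) (qK p + qK q)"
definition "p - q = Quat (qRe p - qRe q) (qI p - qI q) (qJ p - qJ q) (qK p - qK q)"
definition "- q = Quat (- qRe q) (- qI q) (- qJ q) (- qK q)"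
definition "p * q = Quat
  (qRe p * qRe q - qI p * qI q - qJ p * qJ q - qK p * qK q)
  (qRe p * qI q + qI p * qRe q + qJ p * qK q - qK p * qJ q)
  (qRe p * qJ q - qI p * qK q + qJ p * qRe q + qK p * qI q)
  (qRe p * qK q + qI p * qJ q - qJ p * qI q + qK p * qRe q)"
instance
  by standard (auto simp: zero_quat_def one_quat_def plus_quat_def minus_quat_def
      uminus_quat_def times_quat_def algebra_simps)
end

instantiation quat :: real_algebra_1
begin
definition "r *\<^sub>R q = Quat (r * qRe q) (r * qI q) (r * qJ q) (r * qK q)"
instance
  by standard (auto simp: scaleR_quat_def one_quat_def plus_quat_def times_quat_def algebra_simps)
end

instantiation quat :: real_inner
begin
definition "p \<bullet> q = qRe p * qRe q + qI p * qI q + qJ p * qJ q + qK p * qK q"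
definition "norm (q::quat) = sqrt (q \<bullet> q)"
definition "sgn (q::quat) = q /\<^sub>R norm q"
definition "dist (p::quat) q = norm (p - q)"
definition [code del]: "uniformity = (INF e\<in>{0<..}. principal {(x::quat, y). dist x y < e})"
definition [code del]:
  "open (U::quat set) = (\<forall>x\<in>U. eventually (\<lambda>(x', y). x' = x \<longrightarrow> y \<in> U) uniformity)"
instance
proof
  fix p q x :: quat and r :: real
  show "0 \<le> x \<bullet> x"
    by (simp add: inner_quat_def)
  have sq: "a * a + b * b + c * c + d * d = 0 \<longleftrightarrow> a = 0 \<and> b = 0 \<and> c = 0 \<and> d = 0" for a b c d :: real
    by (smt (verit) mult_eq_0_iff zero_le_square)
  show "x \<bullet> x = 0 \<longleftrightarrow> x = 0"
    by (simp add: inner_quat_def sq quat_eq_iff zero_quat_def)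
qed (auto simp: inner_quat_def plus_quat_def scaleR_quat_def algebra_simps norm_quat_def
      sgn_quat_def dist_quat_def uniformity_quat_def open_quat_def)
end

instance quat :: real_normed_algebra_1
proof
  have mult: "norm (p * q) = norm p * norm q" for p q :: quat
    by (simp add: norm_quat_def inner_quat_def times_quat_def flip: real_sqrt_mult)
       (simp add: algebra_simps)
  show "norm (p * q) \<le> norm p * norm q" for p q :: quat
    by (simp add: mult)
  show "norm (1::quat) = 1"
    by (simp add: norm_quat_def inner_quat_def one_quat_def)
qed

definition qcnj :: "quat \<Rightarrow> quat"
  where "qcnj q = Quat (qRe q) (- qI q) (- qJ q) (- qK q)"


section \<open>Quaternionic vector spaces\<close>

text \<open>
  The carrier \<open>X\<close> is an additive subgroup of an ambient abelian group, so that one notion serves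
  both for algebras (carrier \<open>UNIV\<close>) and for spaces that are quantified existentially.
  Real scalars are the quaternions \<open>of_real r\<close>.
\<close>

locale right_H_module =
  fixes X :: "'v::ab_group_add set"
    and rmul :: "'v \<Rightarrow> quat \<Rightarrow> 'v"
  assumes zero_closed: "0 \<in> X"
    and add_closed: "\<lbrakk>x \<in> X; y \<in> X\<rbrakk> \<Longrightarrow> x + y \<in> X"
    and uminus_closed: "x \<in> X \<Longrightarrow> - x \<in> X"
    and rmul_closed: "x \<in> X \<Longrightarrow> rmul x \<alpha> \<in> X"
    and rmul_one: "x \<in> X \<Longrightarrow> rmul x 1 = x"
    and rmul_rmul: "x \<in> X \<Longrightarrow> rmul (rmul x \<alpha>) \<beta> = rmul x (\<alpha> * \<beta>)"
    and rmul_add_left: "\<lbrakk>x \<in> X; y \<in> X\<rbrakk> \<Longrightarrow> rmul (x + y) \<alpha> = rmul x \<alpha> + rmul y \<alpha>"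
    and rmul_add_right: "x \<in> X \<Longrightarrow> rmul x (\<alpha> + \<beta>) = rmul x \<alpha> + rmul x \<beta>"

locale H_vector_space = right_H_module X rmul
  for X :: "'v::ab_group_add set"
    and lmul :: "quat \<Rightarrow> 'v \<Rightarrow> 'v"
    and rmul :: "'v \<Rightarrow> quat \<Rightarrow> 'v" +
  assumes lmul_closed: "x \<in> X \<Longrightarrow> lmul \<alpha> x \<in> X"
    and lmul_one: "x \<in> X \<Longrightarrow> lmul 1 x = x"
    and lmul_lmul: "x \<in> X \<Longrightarrow> lmul \<alpha> (lmul \<beta> x) = lmul (\<alpha> * \<beta>) x"
    and lmul_add_right: "\<lbrakk>x \<in> X; y \<in> X\<rbrakk> \<Longrightarrow> lmul \<alpha> (x + y) = lmul \<alpha> x + lmul \<alpha> y"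
    and lmul_add_left: "x \<in> X \<Longrightarrow> lmul (\<alpha> + \<beta>) x = lmul \<alpha> x + lmul \<beta> x"
    and lmul_rmul: "x \<in> X \<Longrightarrow> rmul (lmul \<alpha> x) \<beta> = lmul \<alpha> (rmul x \<beta>)"
    and real_central: "x \<in> X \<Longrightarrow> lmul (of_real r) x = rmul x (of_real r)"


section \<open>Quaternionic \<open>B\<^sup>*\<close>-algebras\<close>

text \<open>On types that already carry a real structure, it has to be the one induced by the bimodule.\<close>

locale H_vector_space_type = H_vector_space UNIV lmul rmul
  for lmul :: "quat \<Rightarrow> 'a::real_vector \<Rightarrow> 'a"
    and rmul :: "'a \<Rightarrow> quat \<Rightarrow> 'a" +
  assumes lmul_of_real: "lmul (of_real r) x = r *\<^sub>R x"

locale H_normed_space = H_vector_space_type lmul rmul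
  for lmul :: "quat \<Rightarrow> 'a::real_normed_vector \<Rightarrow> 'a"
    and rmul :: "'a \<Rightarrow> quat \<Rightarrow> 'a" +
  assumes norm_lmul_rmul_le: "norm (rmul (lmul \<alpha> x) \<beta>) \<le> norm \<alpha> * norm x * norm \<beta>"

locale H_algebra = H_vector_space_type lmul rmul
  for lmul :: "quat \<Rightarrow> 'a::real_algebra \<Rightarrow> 'a"
    and rmul :: "'a \<Rightarrow> quat \<Rightarrow> 'a" +
  assumes lmul_times: "lmul \<gamma> a * b = lmul \<gamma> (a * b)"
    and rmul_times: "rmul a \<gamma> * b = a * lmul \<gamma> b"
    and times_rmul: "rmul (a * b) \<gamma> = a * rmul b \<gamma>"

locale H_involution_algebra = H_algebra lmul rmul
  for lmul :: "quat \<Rightarrow> 'a::real_algebra \<Rightarrow> 'a"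
    and rmul :: "'a \<Rightarrow> quat \<Rightarrow> 'a"
    and star :: "'a \<Rightarrow> 'a" +
  assumes star_star: "star (star a) = a"
    and star_add: "star (a + b) = star a + star b"
    and star_scaleR: "star (r *\<^sub>R a) = r *\<^sub>R star a"
    and star_times: "star (a * b) = star b * star a"
    and star_lmul: "star (lmul \<alpha> b) = rmul (star b) (qcnj \<alpha>)"
    and star_rmul: "star (rmul b \<alpha>) = lmul (qcnj \<alpha>) (star b)"

text \<open>
  Submultiplicativity and completeness of the norm come from the classes \<open>real_normed_algebra\<close>
  (which requires no unit) and \<open>banach\<close>.
\<close>

locale H_Bstar_algebra = H_involution_algebra lmul rmul star + H_normed_space lmul rmul
  for lmul :: "quat \<Rightarrow> 'a::{real_normed_algebra, banach} \<Rightarrow> 'a"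
    and rmul :: "'a \<Rightarrow> quat \<Rightarrow> 'a"
    and star :: "'a \<Rightarrow> 'a" +
  assumes Bstar_identity: "norm (star a * a) = (norm a)\<^sup>2"


section \<open>Hilbert bimodules\<close>

locale H_inner_product = right_H_module Y rmul
  for Y :: "'v::ab_group_add set"
    and rmul :: "'v \<Rightarrow> quat \<Rightarrow> 'v" +
  fixes ip :: "'v \<Rightarrow> 'v \<Rightarrow> quat"
  assumes ip_right_linear:
      "\<lbrakk>x \<in> Y; y \<in> Y; z \<in> Y\<rbrakk> \<Longrightarrow> ip x (y + rmul z \<beta>) = ip x y + ip x z * \<beta>"
    and ip_commute: "\<lbrakk>x \<in> Y; y \<in> Y\<rbrakk> \<Longrightarrow> ip y x = qcnj (ip x y)"
    and ip_nonneg: "x \<in> Y \<Longrightarrow> \<exists>r\<ge>0. ip x x = of_real r"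
    and ip_definite: "\<lbrakk>x \<in> Y; ip x x = 0\<rbrakk> \<Longrightarrow> x = 0"

definition ip_norm :: "('v \<Rightarrow> 'v \<Rightarrow> quat) \<Rightarrow> 'v \<Rightarrow> real"
  where "ip_norm ip y = sqrt (norm (ip y y))"

locale Hilbert_H_bimodule = H_vector_space Y lmul rmul + H_inner_product Y rmul ip
  for Y :: "'v::ab_group_add set"
    and lmul :: "quat \<Rightarrow> 'v \<Rightarrow> 'v"
    and rmul :: "'v \<Rightarrow> quat \<Rightarrow> 'v"
    and ip :: "'v \<Rightarrow> 'v \<Rightarrow> quat" +
  assumes ip_lmul: "\<lbrakk>x \<in> Y; y \<in> Y\<rbrakk> \<Longrightarrow> ip (lmul \<alpha> x) y = ip x (lmul (qcnj \<alpha>) y)"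
    and complete:
      "\<lbrakk>\<And>n. s n \<in> Y; \<And>e. e > 0 \<Longrightarrow> \<exists>N. \<forall>m\<ge>N. \<forall>n\<ge>N. ip_norm ip (s m - s n) < e\<rbrakk>
        \<Longrightarrow> \<exists>l\<in>Y. (\<lambda>n. ip_norm ip (s n - l)) \<longlonglongrightarrow> 0"


section \<open>The algebra of adjointable right module maps\<close>

text \<open>
  A map on \<open>Y\<close> is represented by the function on the ambient type that is \<open>undefined\<close> outside \<open>Y\<close>
  (\<open>Y \<rightarrow>\<^sub>E Y\<close>), so that equality of representatives is equality of maps on \<open>Y\<close>.
\<close>

definition adjoint_pair ::
    "'v set \<Rightarrow> ('v \<Rightarrow> 'v \<Rightarrow> quat) \<Rightarrow> ('v \<Rightarrow> 'v) \<Rightarrow> ('v \<Rightarrow> 'v) \<Rightarrow> bool"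
  where "adjoint_pair Y ip T S \<longleftrightarrow> (\<forall>x\<in>Y. \<forall>y\<in>Y. ip (T x) y = ip x (S y))"

definition LHr ::
    "'v::ab_group_add set \<Rightarrow> ('v \<Rightarrow> quat \<Rightarrow> 'v) \<Rightarrow> ('v \<Rightarrow> 'v \<Rightarrow> quat) \<Rightarrow> ('v \<Rightarrow> 'v) set"
  where "LHr Y rmul ip = {T \<in> Y \<rightarrow>\<^sub>E Y.
    (\<forall>x\<in>Y. \<forall>y\<in>Y. T (x + y) = T x + T y) \<and>
    (\<forall>x\<in>Y. \<forall>\<alpha>. T (rmul x \<alpha>) = rmul (T x) \<alpha>) \<and>
    (\<exists>S \<in> Y \<rightarrow>\<^sub>E Y. adjoint_pair Y ip T S)}"

definition op_add :: "'v::ab_group_add set \<Rightarrow> ('v \<Rightarrow> 'v) \<Rightarrow> ('v \<Rightarrow> 'v) \<Rightarrow> 'v \<Rightarrow> 'v"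
  where "op_add Y S T = (\<lambda>y\<in>Y. S y + T y)"

text \<open>The adjoint is unique because the inner product is definite.\<close>

definition op_adj :: "'v set \<Rightarrow> ('v \<Rightarrow> 'v \<Rightarrow> quat) \<Rightarrow> ('v \<Rightarrow> 'v) \<Rightarrow> 'v \<Rightarrow> 'v"
  where "op_adj Y ip T = (THE S. S \<in> Y \<rightarrow>\<^sub>E Y \<and> adjoint_pair Y ip T S)"

definition Theta :: "'v set \<Rightarrow> (quat \<Rightarrow> 'v \<Rightarrow> 'v) \<Rightarrow> quat \<Rightarrow> 'v \<Rightarrow> 'v"
  where "Theta Y lmul \<alpha> = (\<lambda>y\<in>Y. lmul \<alpha> y)"

definition op_lmul :: "'v set \<Rightarrow> (quat \<Rightarrow> 'v \<Rightarrow> 'v) \<Rightarrow> quat \<Rightarrow> ('v \<Rightarrow> 'v) \<Rightarrow> 'v \<Rightarrow> 'v"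
  where "op_lmul Y lmul \<alpha> T = compose Y (Theta Y lmul \<alpha>) T"

definition op_rmul :: "'v set \<Rightarrow> (quat \<Rightarrow> 'v \<Rightarrow> 'v) \<Rightarrow> ('v \<Rightarrow> 'v) \<Rightarrow> quat \<Rightarrow> 'v \<Rightarrow> 'v"
  where "op_rmul Y lmul T \<alpha> = compose Y T (Theta Y lmul \<alpha>)"

text \<open>
  Adjointable maps on a Hilbert bimodule are automatically bounded (closed graph theorem), so the
  supremum below is a genuine one for members of \<open>LHr\<close>.
\<close>

definition op_norm :: "'v set \<Rightarrow> ('v \<Rightarrow> 'v \<Rightarrow> quat) \<Rightarrow> ('v \<Rightarrow> 'v) \<Rightarrow> real"
  where "op_norm Y ip T = (SUP y\<in>{y \<in> Y. ip_norm ip y \<le> 1}. ip_norm ip (T y))"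

text \<open>
  \<open>lmul\<close>, \<open>rmul\<close>, \<open>star\<close> belong to the source algebra; \<open>Y\<close>, \<open>lY\<close>, \<open>rY\<close>, \<open>ip\<close> to the bimodule.
\<close>

definition H_star_hom ::
    "(quat \<Rightarrow> 'a \<Rightarrow> 'a) \<Rightarrow> ('a \<Rightarrow> quat \<Rightarrow> 'a) \<Rightarrow> ('a \<Rightarrow> 'a) \<Rightarrow>
     'v::ab_group_add set \<Rightarrow> (quat \<Rightarrow> 'v \<Rightarrow> 'v) \<Rightarrow> ('v \<Rightarrow> quat \<Rightarrow> 'v) \<Rightarrow> ('v \<Rightarrow> 'v \<Rightarrow> quat) \<Rightarrow>
     ('a::real_algebra \<Rightarrow> 'v \<Rightarrow> 'v) \<Rightarrow> bool"
  where "H_star_hom lmul rmul star Y lY rY ip \<phi> \<longleftrightarrow>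
    (\<forall>a. \<phi> a \<in> LHr Y rY ip) \<and>
    (\<forall>a b. \<phi> (a + b) = op_add Y (\<phi> a) (\<phi> b)) \<and>
    (\<forall>\<alpha> a. \<phi> (lmul \<alpha> a) = op_lmul Y lY \<alpha> (\<phi> a)) \<and>
    (\<forall>\<alpha> a. \<phi> (rmul a \<alpha>) = op_rmul Y lY (\<phi> a) \<alpha>) \<and>
    (\<forall>a b. \<phi> (a * b) = compose Y (\<phi> a) (\<phi> b)) \<and>
    (\<forall>a. \<phi> (star a) = op_adj Y ip (\<phi> a))"

definition isometric_H_star_hom ::
    "(quat \<Rightarrow> 'a \<Rightarrow> 'a) \<Rightarrow> ('a \<Rightarrow> quat \<Rightarrow> 'a) \<Rightarrow> ('a \<Rightarrow> 'a) \<Rightarrow>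
     'v::ab_group_add set \<Rightarrow> (quat \<Rightarrow> 'v \<Rightarrow> 'v) \<Rightarrow> ('v \<Rightarrow> quat \<Rightarrow> 'v) \<Rightarrow> ('v \<Rightarrow> 'v \<Rightarrow> quat) \<Rightarrow>
     ('a::real_normed_algebra \<Rightarrow> 'v \<Rightarrow> 'v) \<Rightarrow> bool"
  where "isometric_H_star_hom lmul rmul star Y lY rY ip \<phi> \<longleftrightarrow>
    H_star_hom lmul rmul star Y lY rY ip \<phi> \<and> (\<forall>a. op_norm Y ip (\<phi> a) = norm a)"

end

theory Submission
  imports Defs "HOL-Computational_Algebra.Polynomial"
begin

text \<open>
  The proof has two halves: enough positive functionals on \<open>A\<close>, and a Hilbert space on which they
  turn \<open>A\<close> into operators.

  A norm with \<open>\<parallel>a\<^sup>* a\<parallel> = \<parallel>a\<parallel>\<^sup>2\<close> does not make a real algebra an operator algebra; the quaternions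
  have to be used. The elements that commute with the unit \<open>i\<close> form a complex \<open>B\<^sup>*\<close>-algebra \<open>BC\<close>
  with scalar \<open>i\<close>. For a self-adjoint \<open>x\<close> in it and real polynomials \<open>f\<close>, \<open>w\<close> the \<open>B\<^sup>*\<close> identity for
  \<open>f(x) + i w(x)\<close> says that \<open>f(x)\<^sup>2 \<le> f(x)\<^sup>2 + w(x)\<^sup>2\<close> holds in norm
  (\<open>norm_pact_le_sum_squares\<close>). This one inequality replaces spectral theory: an averaging argument
  derives from it that the norm of \<open>f(x)\<close> is, up to sign, an approximate eigenvalue
  (\<open>approx_eigenvalue_norm\<close>). Hence the sublinear function \<open>top_of\<close>, the infimum of
  \<open>\<parallel>s + x\<parallel> - s\<close> over \<open>s \<ge> 0\<close>, is the largest approximate eigenvalue of a self-adjoint \<open>x\<close>, and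
  approximate eigenvalues obey polynomial identities.

  The crux is \<open>y\<^sup>* y \<ge> 0\<close> for \<open>y\<close> in \<open>BC\<close>, in the form \<open>top_of (- y\<^sup>* y) \<le> 0\<close>
  (\<open>top_of_uminus_star_times\<close>). As \<open>y\<^sup>* y\<close> and \<open>y y\<^sup>*\<close> have the same nonzero approximate
  eigenvalues and \<open>y\<^sup>* y + y y\<^sup>*\<close> is a sum of squares of self-adjoint elements, \<open>y\<^sup>* y \<le> K\<close> implies
  \<open>y\<^sup>* y \<ge> - K\<close>. For \<open>K = 1\<close>, passing from \<open>y\<close> to \<open>y (1 - y\<^sup>* y)\<close> replaces the upper bound by
  \<open>1/4\<close> without weakening the negative part, so by scaling the negative part is zero. The Hahn-Banach theorem with the bound
  \<open>top_of\<close> now gives functionals on \<open>A\<close> that are positive on \<open>BC\<close>, and the projection of \<open>A\<close>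
  onto \<open>BC\<close> makes them positive on \<open>A\<close>. The projection costs a constant factor
  (\<open>positive_functional_exists\<close>).

  For a family \<open>\<Phi>\<^sub>a\<close> of positive functionals, the orthogonal sum of the associated Hilbert spaces is
  the function space with kernel \<open>\<Phi>\<^sub>a(b\<^sup>* b')\<close> between \<open>(a, b)\<close> and \<open>(a, b')\<close>, and zero between
  different first indices. Quaternion values instead of real ones tensor this real Hilbert space
  with the quaternions, which provides the right module structure; \<open>A\<close> and the left scalars act
  through the second index, \<open>(c g)(a, b) = g(a, c\<^sup>* b)\<close>. The action of \<open>c\<close> has norm at most \<open>\<parallel>c\<parallel>\<close>,
  by iteration of the Cauchy-Schwarz inequality, and at least \<open>\<parallel>c\<parallel> / 2\<close>, by the choice of the
  \<open>\<Phi>\<^sub>a\<close>. Since both norms satisfy the \<open>B\<^sup>*\<close> identity, the factor disappears when the estimate is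
  applied to the powers \<open>h, h\<^sup>2, h\<^sup>4, \<dots>\<close> of a self-adjoint \<open>h\<close> (\<open>norm_le_opn\<close>).
\<close>

section \<open>Dominated linear functionals\<close>

definition sublinear :: "('a::real_vector \<Rightarrow> real) \<Rightarrow> bool"
  where "sublinear p \<longleftrightarrow>
    (\<forall>x y. p (x + y) \<le> p x + p y) \<and> (\<forall>t>0. \<forall>x. p (t *\<^sub>R x) \<le> t * p x)"

lemma sublinear_add: "sublinear p \<Longrightarrow> p (x + y) \<le> p x + p y"
  by (simp add: sublinear_def)

lemma sublinear_scaleR:
  assumes "sublinear p" "t > 0"
  shows "p (t *\<^sub>R x) = t * p x"
proof (rule antisym)
  have "p (inverse t *\<^sub>R t *\<^sub>R x) \<le> inverse t * p (t *\<^sub>R x)"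
    using assms unfolding sublinear_def by (meson inverse_positive_iff_positive)
  then show "t * p x \<le> p (t *\<^sub>R x)"
    using assms(2) by (simp add: field_simps)
qed (use assms in \<open>simp add: sublinear_def\<close>)

lemma sublinear_zero: "sublinear p \<Longrightarrow> p 0 = 0"
  using sublinear_scaleR [of p 2 0] by simp

lemma sublinear_scaleR_nonneg: "sublinear p \<Longrightarrow> t \<ge> 0 \<Longrightarrow> p (t *\<^sub>R x) = t * p x"
  by (cases "t = 0") (auto simp: sublinear_zero sublinear_scaleR)

lemma sublinear_minus: "sublinear p \<Longrightarrow> - p (- x) \<le> p x"
  using sublinear_add [of p x "- x"] by (simp add: sublinear_zero)

text \<open>
  The largest sublinear function below \<open>p\<close> that takes the value \<open>p a\<close> at \<open>a\<close> and is linear on the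
  line through \<open>a\<close>. A minimal sublinear function agrees with all its tilts, and that makes it additive.
\<close>

definition tilt :: "('a::real_vector \<Rightarrow> real) \<Rightarrow> 'a \<Rightarrow> 'a \<Rightarrow> real"
  where "tilt p a x = (INF t\<in>{0..}. p (x + t *\<^sub>R a) - t * p a)"

lemma tilt_le:
  assumes "sublinear p" "t \<ge> 0"
  shows "tilt p a x \<le> p (x + t *\<^sub>R a) - t * p a"
  unfolding tilt_def
proof (rule cINF_lower)
  have "- p (- x) \<le> p (x + t *\<^sub>R a) - t * p a" if "t \<ge> 0" for t
    using sublinear_add [OF assms(1), of "x + t *\<^sub>R a" "- x"]
      sublinear_scaleR_nonneg [OF assms(1) that, of a] by simp
  then show "bdd_below ((\<lambda>t. p (x + t *\<^sub>R a) - t * p a) ` {0..})"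
    by (intro bdd_belowI [of _ "- p (- x)"]) auto
qed (use assms in auto)

lemma le_tiltI: "(\<And>t. t \<ge> 0 \<Longrightarrow> c \<le> p (x + t *\<^sub>R a) - t * p a) \<Longrightarrow> c \<le> tilt p a x"
  unfolding tilt_def by (rule cINF_greatest) auto

lemma sublinear_tilt:
  assumes "sublinear p"
  shows "sublinear (tilt p a)"
  unfolding sublinear_def
proof (intro conjI allI impI)
  fix x y
  have "tilt p a (x + y) - (p (x + s *\<^sub>R a) - s * p a) \<le> p (y + t *\<^sub>R a) - t * p a"
    if "s \<ge> 0" "t \<ge> 0" for s t
    using tilt_le [OF assms, of "s + t" a "x + y"] that
      sublinear_add [OF assms, of "x + s *\<^sub>R a" "y + t *\<^sub>R a"]
    by (simp add: algebra_simps)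
  then have "tilt p a (x + y) - (p (x + s *\<^sub>R a) - s * p a) \<le> tilt p a y" if "s \<ge> 0" for s
    using that by (intro le_tiltI) auto
  then have "tilt p a (x + y) - tilt p a y \<le> tilt p a x"
    by (intro le_tiltI) (simp add: algebra_simps)
  then show "tilt p a (x + y) \<le> tilt p a x + tilt p a y"
    by simp
next
  fix c :: real and x assume c: "c > 0"
  have "tilt p a (c *\<^sub>R x) / c \<le> p (x + t *\<^sub>R a) - t * p a" if "t \<ge> 0" for t
  proof -
    have "tilt p a (c *\<^sub>R x) \<le> p (c *\<^sub>R (x + t *\<^sub>R a)) - (c * t) * p a"
      using tilt_le [OF assms, of "c * t" a "c *\<^sub>R x"] that c by (simp add: algebra_simps)
    also have "\<dots> = c * (p (x + t *\<^sub>R a) - t * p a)"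
      using sublinear_scaleR [OF assms c, of "x + t *\<^sub>R a"] by (simp add: algebra_simps)
    finally show ?thesis
      using c by (simp add: field_simps)
  qed
  then have "tilt p a (c *\<^sub>R x) / c \<le> tilt p a x"
    by (rule le_tiltI)
  then show "tilt p a (c *\<^sub>R x) \<le> c * tilt p a x"
    using c by (simp add: field_simps)
qed

lemma tilt_below: "sublinear p \<Longrightarrow> tilt p a x \<le> p x"
  using tilt_le [of p 0 a x] by simp

lemma tilt_opposite: "sublinear p \<Longrightarrow> tilt p a (- a) \<le> - p a"
  using tilt_le [of p 1 a "- a"] by (simp add: sublinear_zero)

lemma sublinear_minimal_exists:
  fixes p :: "'a::real_vector \<Rightarrow> real"
  assumes p: "sublinear p"
  obtains m where "sublinear m" "\<And>x. m x \<le> p x"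
    "\<And>q. sublinear q \<Longrightarrow> (\<And>x. q x \<le> m x) \<Longrightarrow> q = m"
proof -
  define A where "A = {q. sublinear q \<and> q \<le> p}"
  define P :: "('a \<Rightarrow> real) \<Rightarrow> ('a \<Rightarrow> real) \<Rightarrow> bool" where "P = (\<lambda>q r. r \<le> q)"
  have "\<exists>m\<in>A. \<forall>a\<in>A. P m a \<longrightarrow> a = m"
  proof (rule predicate_Zorn)
    show "partial_order_on A (relation_of P A)"
      by (rule partial_order_on_relation_ofI) (auto simp: P_def)
  next
    fix C assume "C \<in> Chains (relation_of P A)"
    then have CA: "C \<subseteq> A" and ch: "\<And>q r. q \<in> C \<Longrightarrow> r \<in> C \<Longrightarrow> q \<le> r \<or> r \<le> q"
      by (auto simp: Chains_def relation_of_def P_def)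
    show "\<exists>u\<in>A. \<forall>a\<in>C. P a u"
    proof (cases "C = {}")
      case True
      then show ?thesis using p by (auto simp: A_def)
    next
      case False
      define u where "u x = (INF q\<in>C. q x)" for x
      have bd: "bdd_below ((\<lambda>q. q x) ` C)" for x
      proof (intro bdd_belowI [of _ "- p (- x)"])
        fix r assume "r \<in> (\<lambda>q. q x) ` C"
        then obtain q where q: "q \<in> C" "r = q x" by auto
        then have "sublinear q" "q (- x) \<le> p (- x)"
          using CA by (auto simp: A_def le_fun_def)
        then show "- p (- x) \<le> r"
          using sublinear_minus [of q x] q(2) by simp
      qed
      have low: "u x \<le> q x" if "q \<in> C" for q x
        unfolding u_def using bd that by (rule cINF_lower)
      have gr: "c \<le> u x" if "\<And>q. q \<in> C \<Longrightarrow> c \<le> q x" for c x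
        unfolding u_def using False that by (intro cINF_greatest) auto
      have "sublinear u"
        unfolding sublinear_def
      proof (intro conjI allI impI)
        fix x y
        have "u (x + y) - q x \<le> r y" if qr: "q \<in> C" "r \<in> C" for q r
        proof -
          obtain s where s: "s \<in> C" "s x \<le> q x" "s y \<le> r y"
            using ch [OF qr] qr order_refl unfolding le_fun_def by metis
          then have "sublinear s"
            using CA by (auto simp: A_def)
          then have "u (x + y) \<le> s x + s y"
            using low [OF s(1), of "x + y"] sublinear_add [of s x y] by simp
          then show ?thesis using s by simp
        qed
        then have "u (x + y) - q x \<le> u y" if "q \<in> C" for q
          using that by (intro gr) auto
        then have "u (x + y) - u y \<le> u x"
          by (intro gr) (simp add: algebra_simps)
        then show "u (x + y) \<le> u x + u y" by simp
      next
        fix t :: real and x assume t: "t > 0"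
        have "u (t *\<^sub>R x) / t \<le> q x" if "q \<in> C" for q
          using low [OF that, of "t *\<^sub>R x"] sublinear_scaleR [of q t x] t CA that
          by (auto simp: A_def field_simps)
        then have "u (t *\<^sub>R x) / t \<le> u x"
          by (rule gr)
        then show "u (t *\<^sub>R x) \<le> t * u x"
          using t by (simp add: field_simps)
      qed
      moreover have "u \<le> p"
      proof (rule le_funI)
        fix x
        obtain q where "q \<in> C" using False by auto
        then show "u x \<le> p x"
          using low [of q x] CA by (auto simp: A_def le_fun_def intro: order_trans)
      qed
      ultimately show ?thesis
        using low by (auto simp: A_def P_def le_fun_def)
    qed
  qed
  then obtain m where m: "sublinear m" "m \<le> p"
    and min: "\<And>q. sublinear q \<Longrightarrow> q \<le> p \<Longrightarrow> q \<le> m \<Longrightarrow> q = m"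
    by (auto simp: A_def P_def)
  show thesis
  proof (rule that)
    fix q assume "sublinear q" "\<And>x. q x \<le> m x"
    then show "q = m"
      using min [of q] m(2) by (meson le_funI order_trans)
  qed (use m in \<open>auto simp: le_fun_def\<close>)
qed

theorem Hahn_Banach_at_point:
  fixes p :: "'a::real_vector \<Rightarrow> real"
  assumes p: "sublinear p"
  obtains f where "linear f" "\<And>x. f x \<le> p x" "f k = p k"
proof -
  obtain m where m: "sublinear m" "\<And>x. m x \<le> tilt p k x"
    and min: "\<And>q. sublinear q \<Longrightarrow> (\<And>x. q x \<le> m x) \<Longrightarrow> q = m"
    using sublinear_minimal_exists [OF sublinear_tilt [OF p, of k]] by blast
  have "tilt m a = m" for a
    using m(1) by (intro min) (auto simp: sublinear_tilt tilt_below)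
  then have "m x \<le> m (x + a) - m a" for x a
    using tilt_le [OF m(1), of 1 a x] by simp
  then have add: "m (x + a) = m x + m a" for x a
    using sublinear_add [OF m(1), of x a] by (simp add: algebra_simps antisym)
  have neg: "m (- x) = - m x" for x
    using add [of x "- x"] by (simp add: sublinear_zero [OF m(1)])
  have "m (t *\<^sub>R x) = t * m x" for t x
    using sublinear_scaleR_nonneg [OF m(1), of t x]
      sublinear_scaleR_nonneg [OF m(1), of "- t" x] neg [of "t *\<^sub>R x"]
    by (cases "t \<ge> 0") auto
  then have lin: "linear m"
    by (intro linearI) (auto simp: add)
  have le: "m x \<le> p x" for x
    using m(2) tilt_below [OF p] by (rule order_trans)
  have "m (- k) \<le> - p k"
    using m(2) tilt_opposite [OF p] by (rule order_trans)
  then have "m k = p k"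
    using neg [of k] le [of k] by simp
  with lin le show thesis by (rule that)
qed

section \<open>The Hilbert space of a positive semidefinite kernel\<close>

text \<open>
  A list of weighted points stands for a formal linear combination; concatenation is its sum.
\<close>

definition ev :: "('x \<Rightarrow> real) \<Rightarrow> (real \<times> 'x) list \<Rightarrow> real"
  where "ev F v = (\<Sum>(c, x)\<leftarrow>v. c * F x)"

definition scl :: "real \<Rightarrow> (real \<times> 'x) list \<Rightarrow> (real \<times> 'x) list"
  where "scl t v = map (\<lambda>(c, x). (t * c, x)) v"

lemma ev_Nil [simp]: "ev F [] = 0"
  and ev_Cons [simp]: "ev F ((c, x) # v) = c * F x + ev F v"
  and ev_append [simp]: "ev F (v @ w) = ev F v + ev F w"
  by (simp_all add: ev_def)

lemma scl_Nil [simp]: "scl t [] = []"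
  and scl_Cons [simp]: "scl t ((c, x) # v) = (t * c, x) # scl t v"
  by (simp_all add: scl_def)

lemma ev_scl [simp]: "ev F (scl t v) = t * ev F v"
  by (induction v) (auto simp: algebra_simps)

lemma ev_add: "ev (\<lambda>x. F x + G x) v = ev F v + ev G v"
  by (induction v) (auto simp: algebra_simps)

lemma ev_diff: "ev (\<lambda>x. F x - G x) v = ev F v - ev G v"
  by (induction v) (auto simp: algebra_simps)

lemma ev_cmult: "ev (\<lambda>x. c * F x) v = c * ev F v"
  by (induction v) (auto simp: algebra_simps)

lemma ev_zero [simp]: "ev (\<lambda>x. 0) v = 0"
  by (induction v) auto

lemma ev_swap: "ev (\<lambda>y. ev (K y) v) w = ev (\<lambda>x. ev (\<lambda>y. K y x) w) v"
  by (induction w) (auto simp: ev_add ev_cmult)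

lemma ev_map: "ev F (map (map_prod id \<tau>) v) = ev (\<lambda>x. F (\<tau> x)) v"
  by (induction v) auto

text \<open>The discriminant of a quadratic polynomial that is bounded above.\<close>

lemma quadratic_discriminant_bound:
  fixes a b q :: real
  assumes "\<And>t. 2 * t * a - t\<^sup>2 * b \<le> q" "b \<ge> 0"
  shows "a\<^sup>2 \<le> q * b"
proof (cases "b = 0")
  case True
  have "a = 0"
  proof (rule ccontr)
    assume "a \<noteq> 0"
    then show False
      using assms(1) [of "(q + 1) / (2 * a)"] True by simp
  qed
  then show ?thesis using True by simp
next
  case False
  then show ?thesis
    using assms(1) [of "a / b"] assms(2) by (simp add: field_simps power2_eq_square)
qed

locale pos_kernel =
  fixes K :: "'x \<Rightarrow> 'x \<Rightarrow> real"
  assumes K_sym: "K x y = K y x"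
    and K_psd: "0 \<le> ev (\<lambda>x. ev (K x) v) v"
begin

definition kf :: "(real \<times> 'x) list \<Rightarrow> 'x \<Rightarrow> real"
  where "kf v y = ev (K y) v"

definition B :: "(real \<times> 'x) list \<Rightarrow> (real \<times> 'x) list \<Rightarrow> real"
  where "B v w = ev (kf v) w"

lemma kf_Nil [simp]: "kf [] = (\<lambda>y. 0)"
  and kf_append: "kf (v @ w) = (\<lambda>y. kf v y + kf w y)"
  and kf_scl: "kf (scl t v) = (\<lambda>y. t * kf v y)"
  by (auto simp: kf_def)

lemma B_commute: "B v w = B w v"
  unfolding B_def kf_def by (subst ev_swap) (simp add: K_sym)

lemma B_simps [simp]:
  "B v [] = 0" "B [] v = 0"
  "B u (v @ w) = B u v + B u w" "B (v @ w) u = B v u + B w u"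
  "B u (scl t v) = t * B u v" "B (scl t v) u = t * B v u"
  by (auto simp: B_def kf_append kf_scl ev_add ev_cmult)

lemma B_nonneg [simp]: "0 \<le> B v v"
  using K_psd [of v] by (simp add: B_def kf_def [abs_def])

lemma ev_kf: "ev (kf v) w = B v w"
  by (simp add: B_def)

text \<open>
  \<open>Q F\<close> is the squared norm of \<open>F\<close>, written as the Legendre transform of the quadratic form \<open>B\<close>. In
  this form adding a kernel function has an explicit effect. The space \<open>D\<close> of all functions with
  finite norm is complete, and the kernel functions are dense in it.
\<close>

definition D :: "('x \<Rightarrow> real) set"
  where "D = {F. bdd_above (range (\<lambda>v. 2 * ev F v - B v v))}"

definition Q :: "('x \<Rightarrow> real) \<Rightarrow> real"
  where "Q F = (SUP v. 2 * ev F v - B v v)"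

abbreviation nu :: "('x \<Rightarrow> real) \<Rightarrow> real"
  where "nu F \<equiv> sqrt (Q F)"

lemma le_Q: "F \<in> D \<Longrightarrow> 2 * ev F v - B v v \<le> Q F"
  unfolding Q_def D_def by (rule cSUP_upper) auto

lemma Q_nonneg: "F \<in> D \<Longrightarrow> 0 \<le> Q F"
  using le_Q [of F "[]"] by simp

lemma D_QI:
  assumes "\<And>v. 2 * ev F v - B v v \<le> C"
  shows "F \<in> D" "Q F \<le> C"
  using assms unfolding D_def Q_def by (auto intro!: cSUP_least bdd_aboveI)

lemma ev_square_le: "F \<in> D \<Longrightarrow> (ev F v)\<^sup>2 \<le> Q F * B v v"
  using le_Q [of F "scl _ v"]
  by (intro quadratic_discriminant_bound) (auto simp: power2_eq_square mult.assoc)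

lemma ev_le: "F \<in> D \<Longrightarrow> \<bar>ev F v\<bar> \<le> nu F * sqrt (B v v)"
  using real_sqrt_le_mono [OF ev_square_le [of F v]] by (simp add: real_sqrt_mult)

lemma D_nuI:
  assumes "\<And>v. ev F v \<le> C * sqrt (B v v)" "C \<ge> 0"
  shows "F \<in> D" "nu F \<le> C"
proof -
  have *: "2 * ev F v - B v v \<le> C\<^sup>2" for v
  proof -
    have "0 \<le> (C - sqrt (B v v))\<^sup>2" by simp
    then show ?thesis
      using assms(1) [of v] by (simp add: power2_diff)
  qed
  show "F \<in> D" using * by (rule D_QI)
  show "nu F \<le> C"
    using D_QI(2) [OF *] assms(2) by (simp add: real_le_lsqrt)
qed

lemma D_zero [simp]: "(\<lambda>x. 0) \<in> D" and Q_zero [simp]: "Q (\<lambda>x. 0) = 0"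
proof -
  show 1: "(\<lambda>x. 0) \<in> D" by (rule D_nuI [of _ 0]) auto
  have "nu (\<lambda>x. 0) \<le> 0" by (rule D_nuI) auto
  then show "Q (\<lambda>x. 0) = 0"
    using Q_nonneg [OF 1] by simp
qed

lemma
  assumes "F \<in> D" "G \<in> D"
  shows D_add: "(\<lambda>x. F x + G x) \<in> D"
    and nu_triangle: "nu (\<lambda>x. F x + G x) \<le> nu F + nu G"
proof -
  have "ev (\<lambda>x. F x + G x) v \<le> (nu F + nu G) * sqrt (B v v)" for v
    using ev_le [OF assms(1), of v] ev_le [OF assms(2), of v] by (simp add: ev_add algebra_simps)
  moreover have "0 \<le> nu F + nu G"
    using assms by (simp add: Q_nonneg)
  ultimately show "(\<lambda>x. F x + G x) \<in> D" "nu (\<lambda>x. F x + G x) \<le> nu F + nu G"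
    by (blast intro: D_nuI)+
qed

lemma
  assumes "F \<in> D"
  shows D_cmult: "(\<lambda>x. c * F x) \<in> D"
    and nu_cmult_le: "nu (\<lambda>x. c * F x) \<le> \<bar>c\<bar> * nu F"
proof -
  have "ev (\<lambda>x. c * F x) v \<le> (\<bar>c\<bar> * nu F) * sqrt (B v v)" for v
  proof -
    have "ev (\<lambda>x. c * F x) v \<le> \<bar>c\<bar> * \<bar>ev F v\<bar>"
      by (simp add: ev_cmult flip: abs_mult)
    also have "\<dots> \<le> \<bar>c\<bar> * (nu F * sqrt (B v v))"
      using ev_le [OF assms, of v] by (intro mult_left_mono) auto
    finally show ?thesis by (simp add: mult.assoc)
  qed
  moreover have "0 \<le> \<bar>c\<bar> * nu F"
    using assms by (simp add: Q_nonneg)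
  ultimately show "(\<lambda>x. c * F x) \<in> D" "nu (\<lambda>x. c * F x) \<le> \<bar>c\<bar> * nu F"
    by (blast intro: D_nuI)+
qed

lemma D_minus: "F \<in> D \<Longrightarrow> (\<lambda>x. - F x) \<in> D"
  using D_cmult [of F "-1"] by simp

lemma D_diff: "F \<in> D \<Longrightarrow> G \<in> D \<Longrightarrow> (\<lambda>x. F x - G x) \<in> D"
  using D_add [of F "\<lambda>x. - G x"] D_minus [of G] by simp

lemma Q_cmult:
  assumes "F \<in> D"
  shows "Q (\<lambda>x. c * F x) = c\<^sup>2 * Q F"
proof -
  have le: "Q (\<lambda>x. c * F x) \<le> c\<^sup>2 * Q F" if "F \<in> D" for c F
    using power_mono [OF nu_cmult_le [OF that, of c], of 2] that
    by (simp add: power_mult_distrib Q_nonneg D_cmult)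
  show ?thesis
  proof (cases "c = 0")
    case False
    have "c\<^sup>2 * Q F = c\<^sup>2 * Q (\<lambda>x. inverse c * (c * F x))"
      using False by (simp flip: mult.assoc)
    also have "\<dots> \<le> c\<^sup>2 * ((inverse c)\<^sup>2 * Q (\<lambda>x. c * F x))"
      using assms by (intro mult_left_mono le D_cmult) auto
    also have "\<dots> = Q (\<lambda>x. c * F x)"
      using False by (simp add: field_simps)
    finally show ?thesis
      using le [OF assms, of c] by simp
  qed simp
qed

lemma Q_minus: "F \<in> D \<Longrightarrow> Q (\<lambda>x. - F x) = Q F"
  using Q_cmult [of F "-1"] by simp

lemma Q_diff_commute: "F \<in> D \<Longrightarrow> G \<in> D \<Longrightarrow> Q (\<lambda>x. F x - G x) = Q (\<lambda>x. G x - F x)"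
  using Q_minus [OF D_diff [of G F]] by simp

lemma B_cauchy_schwarz: "(B v w)\<^sup>2 \<le> B v v * B w w"
proof (rule quadratic_discriminant_bound)
  fix t
  have "0 \<le> B (v @ scl (- t) w) (v @ scl (- t) w)" by (rule B_nonneg)
  then show "2 * t * B v w - t\<^sup>2 * B w w \<le> B v v"
    by (simp add: B_commute [of w v] power2_eq_square algebra_simps)
qed simp

lemma D_kf: "kf v \<in> D"
proof (rule D_nuI(1))
  show "ev (kf v) w \<le> sqrt (B v v) * sqrt (B w w)" for w
    using real_sqrt_le_mono [OF B_cauchy_schwarz [of v w]]
    by (simp add: ev_kf real_sqrt_mult)
qed simp

text \<open>Adding \<open>kf v\<close> only translates the variable of the supremum that defines \<open>Q\<close>.\<close>

lemma Q_add_kf: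
  assumes "F \<in> D"
  shows "Q (\<lambda>x. F x + kf v x) = Q F + 2 * ev F v + B v v"
proof -
  have le: "Q (\<lambda>x. F x + kf v x) \<le> Q F + 2 * ev F v + B v v" if "F \<in> D" for F v
  proof (rule D_QI(2))
    fix u
    show "2 * ev (\<lambda>x. F x + kf v x) u - B u u \<le> Q F + 2 * ev F v + B v v"
      using le_Q [OF that, of "u @ scl (-1) v"]
      by (simp add: ev_add ev_kf B_commute [of v u])
  qed
  have "Q F \<le> Q (\<lambda>x. F x + kf v x) + 2 * ev (\<lambda>x. F x + kf v x) (scl (-1) v) + B v v"
    using le [OF D_add [OF assms D_kf], of v "scl (-1) v"] by (simp add: kf_scl)
  then show ?thesis
    using le [OF assms, of v] by (simp add: ev_add ev_kf)
qed

lemma Q_diff_kf: "F \<in> D \<Longrightarrow> Q (\<lambda>x. F x - kf v x) = Q F - 2 * ev F v + B v v"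
  using Q_add_kf [of F "scl (-1) v"] by (simp add: kf_scl)

lemma kf_dense:
  assumes "F \<in> D" "e > 0"
  obtains v where "nu (\<lambda>x. F x - kf v x) < e"
proof -
  have "Q F - e\<^sup>2 < Q F" using assms by simp
  then obtain v where "Q F - e\<^sup>2 < 2 * ev F v - B v v"
    using assms(1) unfolding Q_def D_def by (subst (asm) less_cSUP_iff) auto
  then have "Q (\<lambda>x. F x - kf v x) < e\<^sup>2"
    by (simp add: Q_diff_kf [OF assms(1)])
  then have "nu (\<lambda>x. F x - kf v x) < e"
    using assms(2) by (simp add: real_less_lsqrt)
  then show thesis by (rule that)
qed

text \<open>Polarization; that \<open>R\<close> is bilinear does not come from algebra alone, see below.\<close>

definition R :: "('x \<Rightarrow> real) \<Rightarrow> ('x \<Rightarrow> real) \<Rightarrow> real"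
  where "R F G = (Q (\<lambda>x. F x + G x) - Q (\<lambda>x. F x - G x)) / 4"

lemma R_commute: "F \<in> D \<Longrightarrow> G \<in> D \<Longrightarrow> R F G = R G F"
  using Q_diff_commute [of F G] by (simp add: R_def add.commute)

lemma R_self: "F \<in> D \<Longrightarrow> R F F = Q F"
  using Q_cmult [of F 2] by (simp add: R_def)

lemma R_crude_bound:
  assumes "E \<in> D" "G \<in> D"
  shows "\<bar>R E G\<bar> \<le> nu E * (nu G + nu E)"
proof -
  let ?p = "nu (\<lambda>x. E x + G x)" and ?m = "nu (\<lambda>x. E x - G x)"
  have "?p \<le> nu E + nu G" "?m \<le> nu E + nu G"
    using nu_triangle [OF assms] nu_triangle [OF assms(1) D_minus [OF assms(2)]] Q_minus assms
    by auto
  moreover have "?p \<le> ?m + 2 * nu E" "?m \<le> ?p + 2 * nu E"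
  proof -
    have 2: "nu (\<lambda>x. 2 * E x) = 2 * nu E"
      using assms by (simp add: Q_cmult real_sqrt_mult)
    have "?p \<le> nu (\<lambda>x. 2 * E x) + nu (\<lambda>x. G x - E x)"
      using nu_triangle [OF D_cmult [OF assms(1), of 2] D_diff [OF assms(2,1)]]
      by (simp add: algebra_simps)
    then show "?p \<le> ?m + 2 * nu E"
      using 2 Q_diff_commute [OF assms] by simp
    have "?m \<le> nu (\<lambda>x. 2 * E x) + nu (\<lambda>x. - (E x + G x))"
      using nu_triangle [OF D_cmult [OF assms(1), of 2] D_minus [OF D_add [OF assms]]]
      by (simp add: algebra_simps)
    then show "?m \<le> ?p + 2 * nu E"
      using 2 Q_minus [OF D_add [OF assms]] by simp
  qed
  ultimately have "\<bar>?p - ?m\<bar> * (?p + ?m) \<le> (2 * nu E) * (2 * (nu E + nu G))"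
    using assms by (intro mult_mono) (auto simp: Q_nonneg D_add D_diff)
  moreover have "\<bar>?p - ?m\<bar> * (?p + ?m) = \<bar>4 * R E G\<bar>"
  proof -
    have "(?p - ?m) * (?p + ?m) = 4 * R E G"
      using assms by (simp add: R_def algebra_simps Q_nonneg D_add D_diff)
    moreover have "?p + ?m \<ge> 0"
      using assms by (simp add: Q_nonneg D_add D_diff)
    ultimately show ?thesis
      by (metis abs_mult abs_of_nonneg)
  qed
  ultimately show ?thesis by (simp add: algebra_simps)
qed

text \<open>
  Split \<open>F\<close> into \<open>kf v\<close> and an error: the first part contributes exactly \<open>ev G v\<close>.
\<close>

lemma R_approx:
  assumes "F \<in> D" "G \<in> D"
  shows "\<bar>R F G - ev G v\<bar> \<le> nu (\<lambda>x. F x - kf v x) * (nu G + nu (\<lambda>x. F x - kf v x))"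
proof -
  define E where "E = (\<lambda>x. F x - kf v x)"
  have E: "E \<in> D" and F: "F = (\<lambda>x. E x + kf v x)"
    using assms D_kf by (auto simp: E_def D_diff)
  have "Q (\<lambda>x. F x + G x) = Q (\<lambda>x. E x + G x) + 2 * ev (\<lambda>x. E x + G x) v + B v v"
    using Q_add_kf [OF D_add [OF E assms(2)], of v] by (simp add: F algebra_simps)
  moreover have "Q (\<lambda>x. F x - G x) = Q (\<lambda>x. E x - G x) + 2 * ev (\<lambda>x. E x - G x) v + B v v"
    using Q_add_kf [OF D_diff [OF E assms(2)], of v] by (simp add: F algebra_simps)
  ultimately have "R F G = R E G + ev G v"
    by (simp add: R_def ev_add ev_diff)
  then show ?thesis
    using R_crude_bound [OF E assms(2)] by (simp add: E_def)
qed

text \<open>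
  \<open>R F G\<close> is a limit of the values \<open>ev G v\<close> along combinations \<open>v\<close> that depend on \<open>F\<close> only, so it
  inherits linearity in \<open>G\<close>.
\<close>

lemma R_limit:
  assumes "F \<in> D"
  obtains v where "\<And>G. G \<in> D \<Longrightarrow> (\<lambda>n. ev G (v n)) \<longlonglongrightarrow> R F G"
    "(\<lambda>n. nu (\<lambda>x. F x - kf (v n) x)) \<longlonglongrightarrow> 0"
proof -
  have "\<exists>v. nu (\<lambda>x. F x - kf v x) < 1 / real (Suc n)" for n
    by (rule kf_dense [OF assms, of "1 / real (Suc n)"]) auto
  then obtain v where v: "\<And>n. nu (\<lambda>x. F x - kf (v n) x) < 1 / real (Suc n)"
    by metis
  have lim: "(\<lambda>n. nu (\<lambda>x. F x - kf (v n) x)) \<longlonglongrightarrow> 0"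
  proof (rule tendsto_sandwich [OF _ _ tendsto_const LIMSEQ_inverse_real_of_nat])
    show "\<forall>\<^sub>F n in sequentially. 0 \<le> nu (\<lambda>x. F x - kf (v n) x)"
      using assms D_kf by (auto simp: D_diff Q_nonneg)
    show "\<forall>\<^sub>F n in sequentially. nu (\<lambda>x. F x - kf (v n) x) \<le> inverse (real (Suc n))"
      using v by (intro always_eventually) (auto simp: inverse_eq_divide less_imp_le)
  qed
  show thesis
  proof (rule that [OF _ lim])
    fix G assume G: "G \<in> D"
    let ?E = "\<lambda>n. nu (\<lambda>x. F x - kf (v n) x)"
    have "(\<lambda>n. ?E n * (nu G + ?E n)) \<longlonglongrightarrow> 0"
      using tendsto_mult [OF lim tendsto_add [OF tendsto_const [of "nu G"] lim]] by simp
    then have "(\<lambda>n. ev G (v n) - R F G) \<longlonglongrightarrow> 0"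
      by (rule Lim_null_comparison [rotated])
        (use R_approx [OF assms G] in \<open>auto simp: abs_minus_commute\<close>)
    then show "(\<lambda>n. ev G (v n)) \<longlonglongrightarrow> R F G"
      by (simp add: LIM_zero_iff)
  qed
qed

lemma R_add_right:
  assumes "F \<in> D" "G \<in> D" "H \<in> D"
  shows "R F (\<lambda>x. G x + H x) = R F G + R F H"
proof -
  obtain v where v: "\<And>G. G \<in> D \<Longrightarrow> (\<lambda>n. ev G (v n)) \<longlonglongrightarrow> R F G"
    using R_limit [OF assms(1)] by blast
  have "(\<lambda>n. ev G (v n) + ev H (v n)) \<longlonglongrightarrow> R F G + R F H"
    using assms by (intro tendsto_add v)
  then show ?thesis
    using v [OF D_add [OF assms(2,3)]] by (auto simp: ev_add intro: LIMSEQ_unique)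
qed

lemma R_cmult_right:
  assumes "F \<in> D" "G \<in> D"
  shows "R F (\<lambda>x. c * G x) = c * R F G"
proof -
  obtain v where v: "\<And>G. G \<in> D \<Longrightarrow> (\<lambda>n. ev G (v n)) \<longlonglongrightarrow> R F G"
    using R_limit [OF assms(1)] by blast
  have "(\<lambda>n. c * ev G (v n)) \<longlonglongrightarrow> c * R F G"
    using assms by (intro tendsto_intros v)
  then show ?thesis
    using v [OF D_cmult [OF assms(2)]] by (auto simp: ev_cmult intro: LIMSEQ_unique)
qed

lemma D_point_bound: "F \<in> D \<Longrightarrow> \<bar>F x\<bar> \<le> nu F * sqrt (K x x)"
  using ev_le [of F "[(1, x)]"] by (simp add: B_def kf_def)

lemma Q_eq_0_iff: "F \<in> D \<Longrightarrow> Q F = 0 \<longleftrightarrow> F = (\<lambda>x. 0)"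
  using D_point_bound [of F] by fastforce

text \<open>A Cauchy sequence converges pointwise, and the Cauchy estimates pass to the limit.\<close>

lemma D_complete:
  assumes s: "\<And>n. s n \<in> D"
    and cauchy: "\<And>e. e > 0 \<Longrightarrow> \<exists>N. \<forall>m\<ge>N. \<forall>n\<ge>N. nu (\<lambda>x. s m x - s n x) < e"
  shows "\<exists>F\<in>D. (\<lambda>n. nu (\<lambda>x. s n x - F x)) \<longlonglongrightarrow> 0"
proof -
  have "Cauchy (\<lambda>n. s n x)" for x
  proof (rule metric_CauchyI)
    fix e :: real assume "e > 0"
    define c where "c = 1 + sqrt (K x x)"
    have "K x x \<ge> 0"
      using B_nonneg [of "[(1, x)]"] by (simp add: B_def kf_def)
    then have c: "c > 0" "sqrt (K x x) \<le> c" by (auto simp: c_def add_pos_nonneg)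
    then obtain N where N: "\<And>m n. m \<ge> N \<Longrightarrow> n \<ge> N \<Longrightarrow> nu (\<lambda>x. s m x - s n x) < e / c"
      using cauchy [of "e / c"] \<open>e > 0\<close> by auto
    have "dist (s m x) (s n x) < e" if "m \<ge> N" "n \<ge> N" for m n
    proof -
      have "dist (s m x) (s n x) \<le> nu (\<lambda>x. s m x - s n x) * sqrt (K x x)"
        using D_point_bound [OF D_diff [OF s s]] by (simp add: dist_real_def)
      also have "\<dots> \<le> nu (\<lambda>x. s m x - s n x) * c"
        using c(2) s by (intro mult_left_mono) (auto simp: Q_nonneg D_diff)
      also have "\<dots> < e"
        using N [OF that] c by (simp add: field_simps)
      finally show ?thesis .
    qed
    then show "\<exists>N. \<forall>m\<ge>N. \<forall>n\<ge>N. dist (s m x) (s n x) < e" by blast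
  qed
  then have "\<exists>l. (\<lambda>n. s n x) \<longlonglongrightarrow> l" for x
    by (simp add: Cauchy_convergent_iff convergent_def)
  then obtain F where F: "\<And>x. (\<lambda>n. s n x) \<longlonglongrightarrow> F x"
    by metis
  have evF: "(\<lambda>n. ev (s n) v) \<longlonglongrightarrow> ev F v" for v
    by (induction v) (auto intro!: tendsto_intros F)
  have close: "(\<lambda>x. s n x - F x) \<in> D \<and> nu (\<lambda>x. s n x - F x) \<le> e"
    if N: "\<And>m n. m \<ge> N \<Longrightarrow> n \<ge> N \<Longrightarrow> nu (\<lambda>x. s m x - s n x) < e" and "n \<ge> N" "e > 0" for N n e
  proof -
    have "ev (\<lambda>x. s n x - F x) v \<le> e * sqrt (B v v)" for v
    proof (rule tendsto_upperbound)
      show "(\<lambda>m. ev (\<lambda>x. s n x - s m x) v) \<longlonglongrightarrow> ev (\<lambda>x. s n x - F x) v"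
        unfolding ev_diff by (intro tendsto_intros evF)
      have "ev (\<lambda>x. s n x - s m x) v \<le> e * sqrt (B v v)" if "m \<ge> N" for m
      proof -
        have "ev (\<lambda>x. s n x - s m x) v \<le> nu (\<lambda>x. s n x - s m x) * sqrt (B v v)"
          using ev_le [OF D_diff [OF s s], of n m v] by simp
        also have "\<dots> \<le> e * sqrt (B v v)"
          using N [OF \<open>n \<ge> N\<close> that] by (intro mult_right_mono) auto
        finally show ?thesis .
      qed
      then show "\<forall>\<^sub>F m in sequentially. ev (\<lambda>x. s n x - s m x) v \<le> e * sqrt (B v v)"
        by (auto simp: eventually_sequentially)
    qed simp
    then show ?thesis
      using D_nuI [of "\<lambda>x. s n x - F x" e] \<open>e > 0\<close> by auto
  qed
  have "F \<in> D"
  proof -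
    obtain N where "\<And>m n. m \<ge> N \<Longrightarrow> n \<ge> N \<Longrightarrow> nu (\<lambda>x. s m x - s n x) < 1"
      using cauchy [of 1] by auto
    then have "(\<lambda>x. s N x - F x) \<in> D"
      using close [of N 1 N] by auto
    then show ?thesis
      using D_diff [OF s, of "\<lambda>x. s N x - F x" N] by simp
  qed
  moreover have "(\<lambda>n. nu (\<lambda>x. s n x - F x)) \<longlonglongrightarrow> 0"
  proof (rule LIMSEQ_I)
    fix e :: real assume "e > 0"
    then obtain N where "\<And>m n. m \<ge> N \<Longrightarrow> n \<ge> N \<Longrightarrow> nu (\<lambda>x. s m x - s n x) < e / 2"
      using cauchy [of "e / 2"] by auto
    then have "nu (\<lambda>x. s n x - F x) \<le> e / 2" if "n \<ge> N" for n
      using close [of N "e / 2" n] \<open>e > 0\<close> that by auto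
    then show "\<exists>N. \<forall>n\<ge>N. norm (nu (\<lambda>x. s n x - F x) - 0) < e"
      using \<open>e > 0\<close> s \<open>F \<in> D\<close> by (intro exI [of _ N]) (fastforce simp: Q_nonneg D_diff)
  qed
  ultimately show ?thesis by blast
qed

text \<open>
  A map of the index set that does not increase the form \<open>B\<close> beyond a factor acts on functions by
  composition. Maps that are adjoint for the kernel act by adjoint operators.
\<close>

definition dominated :: "('x \<Rightarrow> 'x) \<Rightarrow> real \<Rightarrow> bool"
  where "dominated \<tau> M \<longleftrightarrow> M \<ge> 0 \<and>
    (\<forall>v. B (map (map_prod id \<tau>) v) (map (map_prod id \<tau>) v) \<le> M\<^sup>2 * B v v)"

lemma
  assumes "dominated \<tau> M" "F \<in> D"
  shows D_comp: "(\<lambda>x. F (\<tau> x)) \<in> D"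
    and nu_comp_le: "nu (\<lambda>x. F (\<tau> x)) \<le> M * nu F"
proof -
  have "ev (\<lambda>x. F (\<tau> x)) v \<le> (M * nu F) * sqrt (B v v)" for v
  proof -
    let ?w = "map (map_prod id \<tau>) v"
    have "ev (\<lambda>x. F (\<tau> x)) v \<le> nu F * sqrt (B ?w ?w)"
      using ev_le [OF assms(2), of ?w] by (simp add: ev_map)
    also have "\<dots> \<le> nu F * sqrt (M\<^sup>2 * B v v)"
      using assms by (intro mult_left_mono) (auto simp: Q_nonneg dominated_def)
    finally show ?thesis
      using assms(1) by (simp add: real_sqrt_mult dominated_def mult_ac)
  qed
  moreover have "0 \<le> M * nu F"
    using assms by (simp add: Q_nonneg dominated_def)
  ultimately show "(\<lambda>x. F (\<tau> x)) \<in> D" "nu (\<lambda>x. F (\<tau> x)) \<le> M * nu F"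
    by (blast intro: D_nuI)+
qed

lemma R_comp_adjoint:
  assumes \<tau>: "dominated \<tau> M" and \<sigma>: "dominated \<sigma> N"
    and adj: "\<And>x y. K (\<tau> x) y = K x (\<sigma> y)"
    and F: "F \<in> D" and G: "G \<in> D"
  shows "R (\<lambda>x. F (\<tau> x)) G = R F (\<lambda>x. G (\<sigma> x))"
proof -
  obtain v where v: "\<And>G. G \<in> D \<Longrightarrow> (\<lambda>n. ev G (v n)) \<longlonglongrightarrow> R F G"
    and E: "(\<lambda>n. nu (\<lambda>x. F x - kf (v n) x)) \<longlonglongrightarrow> 0"
    using R_limit [OF F] by blast
  define w where "w n = map (map_prod id \<sigma>) (v n)" for n
  have kf_w: "kf (w n) x = kf (v n) (\<tau> x)" for n x
    by (simp add: kf_def w_def ev_map flip: adj)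
  have "(\<lambda>n. ev G (w n)) \<longlonglongrightarrow> R (\<lambda>x. F (\<tau> x)) G"
  proof -
    let ?E = "\<lambda>n. nu (\<lambda>x. F (\<tau> x) - kf (w n) x)"
    have le: "0 \<le> ?E n" "?E n \<le> M * nu (\<lambda>x. F x - kf (v n) x)" for n
      subgoal using Q_nonneg [OF D_diff [OF D_comp [OF \<tau> F] D_kf]] by simp
      subgoal using nu_comp_le [OF \<tau> D_diff [OF F D_kf [of "v n"]]] by (simp add: kf_w)
      done
    have "(\<lambda>n. M * nu (\<lambda>x. F x - kf (v n) x)) \<longlonglongrightarrow> 0"
      using tendsto_mult [OF tendsto_const E, of M] by simp
    with always_eventually [OF allI, OF le(1)] always_eventually [OF allI, OF le(2)]
    have E': "?E \<longlonglongrightarrow> 0"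
      by (rule tendsto_sandwich [OF _ _ tendsto_const])
    have "(\<lambda>n. ?E n * (nu G + ?E n)) \<longlonglongrightarrow> 0"
      using tendsto_mult [OF E' tendsto_add [OF tendsto_const [of "nu G"] E']] by simp
    then have "(\<lambda>n. ev G (w n) - R (\<lambda>x. F (\<tau> x)) G) \<longlonglongrightarrow> 0"
      by (rule Lim_null_comparison [rotated])
        (use R_approx [OF D_comp [OF \<tau> F] G] in \<open>auto simp: abs_minus_commute\<close>)
    then show ?thesis
      by (simp add: LIM_zero_iff)
  qed
  moreover have "(\<lambda>n. ev G (w n)) \<longlonglongrightarrow> R F (\<lambda>x. G (\<sigma> x))"
    using v [OF D_comp [OF \<sigma> G]] by (simp add: w_def ev_map)
  ultimately show ?thesis
    by (rule LIMSEQ_unique)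
qed

end

section \<open>Quaternion-valued functions\<close>

lemmas quat_arith = quat_eq_iff zero_quat_def one_quat_def plus_quat_def minus_quat_def
  uminus_quat_def times_quat_def scaleR_quat_def qcnj_def

lemma of_real_quat: "of_real r = Quat r 0 0 0"
  by (simp add: of_real_def scaleR_quat_def one_quat_def)

lemma qcnj_qcnj [simp]: "qcnj (qcnj q) = q"
  and qcnj_mult: "qcnj (p * q) = qcnj q * qcnj p"
  and qcnj_add: "qcnj (p + q) = qcnj p + qcnj q"
  and qcnj_of_real [simp]: "qcnj (of_real r) = of_real r"
  and qcnj_one [simp]: "qcnj 1 = 1"
  by (auto simp: quat_arith of_real_quat algebra_simps)

text \<open>
  The functions whose four coordinates lie in \<open>D\<close> are the tensor product of the real Hilbert space
  \<open>D\<close> with the quaternions. The right multiplication acts on the values only, so it commutes with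
  every operator that acts on the arguments.
\<close>

locale pair_kernel = pos_kernel K
  for K :: "'i \<times> 'b \<Rightarrow> 'i \<times> 'b \<Rightarrow> real"
begin

definition cp :: "(quat \<Rightarrow> real) \<Rightarrow> ('i \<Rightarrow> 'b \<Rightarrow> quat) \<Rightarrow> 'i \<times> 'b \<Rightarrow> real"
  where "cp f g = (\<lambda>x. f (g (fst x) (snd x)))"

definition HQ :: "('i \<Rightarrow> 'b \<Rightarrow> quat) set"
  where "HQ = {g. cp qRe g \<in> D \<and> cp qI g \<in> D \<and> cp qJ g \<in> D \<and> cp qK g \<in> D}"

definition rmH :: "('i \<Rightarrow> 'b \<Rightarrow> quat) \<Rightarrow> quat \<Rightarrow> 'i \<Rightarrow> 'b \<Rightarrow> quat"
  where "rmH g \<alpha> = (\<lambda>i b. g i b * \<alpha>)"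

text \<open>
  This is the sesquilinear extension of \<open>R\<close>: the coordinates of \<open>qcnj g * h\<close>, with products of
  real functions replaced by \<open>R\<close>.
\<close>

definition qip :: "('i \<Rightarrow> 'b \<Rightarrow> quat) \<Rightarrow> ('i \<Rightarrow> 'b \<Rightarrow> quat) \<Rightarrow> quat"
  where "qip g h = (let g0 = cp qRe g; g1 = cp qI g; g2 = cp qJ g; g3 = cp qK g;
      h0 = cp qRe h; h1 = cp qI h; h2 = cp qJ h; h3 = cp qK h in
    Quat (R g0 h0 + R g1 h1 + R g2 h2 + R g3 h3)
         (R g0 h1 - R g1 h0 - R g2 h3 + R g3 h2)
         (R g0 h2 + R g1 h3 - R g2 h0 - R g3 h1)
         (R g0 h3 - R g1 h2 + R g2 h1 - R g3 h0))"

lemma HQ_D: "g \<in> HQ \<Longrightarrow> cp qRe g \<in> D" "g \<in> HQ \<Longrightarrow> cp qI g \<in> D"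
    "g \<in> HQ \<Longrightarrow> cp qJ g \<in> D" "g \<in> HQ \<Longrightarrow> cp qK g \<in> D"
  by (auto simp: HQ_def)

lemma D_combination:
  assumes "F0 \<in> D" "F1 \<in> D" "F2 \<in> D" "F3 \<in> D"
  shows "(\<lambda>x. a * F0 x + b * F1 x + c * F2 x + d * F3 x) \<in> D"
  using assms by (intro D_add D_cmult)

lemma R_combination:
  assumes "G \<in> D" "H \<in> D" "F0 \<in> D" "F1 \<in> D" "F2 \<in> D" "F3 \<in> D"
  shows "R G (\<lambda>x. H x + (a * F0 x + b * F1 x + c * F2 x + d * F3 x))
    = R G H + (a * R G F0 + b * R G F1 + c * R G F2 + d * R G F3)"
  using assms by (simp add: R_add_right R_cmult_right D_add D_cmult)

lemma cp_add: "f \<in> {qRe, qI, qJ, qK} \<Longrightarrow> cp f (g + h) = (\<lambda>x. cp f g x + cp f h x)"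
  by (auto simp: cp_def plus_quat_def fun_eq_iff)

lemma cp_diff: "f \<in> {qRe, qI, qJ, qK} \<Longrightarrow> cp f (g - h) = (\<lambda>x. cp f g x - cp f h x)"
  by (auto simp: cp_def minus_quat_def fun_eq_iff)

lemma cp_uminus: "f \<in> {qRe, qI, qJ, qK} \<Longrightarrow> cp f (- g) = (\<lambda>x. - cp f g x)"
  by (auto simp: cp_def uminus_quat_def fun_eq_iff fun_Compl_def)

lemma cp_zero: "f \<in> {qRe, qI, qJ, qK} \<Longrightarrow> cp f 0 = (\<lambda>x. 0)"
  by (auto simp: cp_def zero_quat_def fun_eq_iff)

lemma cp_rmH:
  "cp qRe (rmH g \<alpha>) = (\<lambda>x. qRe \<alpha> * cp qRe g x + (- qI \<alpha>) * cp qI g x + (- qJ \<alpha>) * cp qJ g x + (- qK \<alpha>) * cp qK g x)"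
  "cp qI (rmH g \<alpha>) = (\<lambda>x. qI \<alpha> * cp qRe g x + qRe \<alpha> * cp qI g x + qK \<alpha> * cp qJ g x + (- qJ \<alpha>) * cp qK g x)"
  "cp qJ (rmH g \<alpha>) = (\<lambda>x. qJ \<alpha> * cp qRe g x + (- qK \<alpha>) * cp qI g x + qRe \<alpha> * cp qJ g x + qI \<alpha> * cp qK g x)"
  "cp qK (rmH g \<alpha>) = (\<lambda>x. qK \<alpha> * cp qRe g x + qJ \<alpha> * cp qI g x + (- qI \<alpha>) * cp qJ g x + qRe \<alpha> * cp qK g x)"
  by (auto simp: cp_def rmH_def times_quat_def fun_eq_iff algebra_simps)

lemma HQ_diff: "g \<in> HQ \<Longrightarrow> h \<in> HQ \<Longrightarrow> g - h \<in> HQ"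
  by (auto simp: HQ_def cp_diff intro!: D_diff)

lemma right_H_module_HQ: "right_H_module HQ rmH"
proof
  show "0 \<in> HQ" by (simp add: HQ_def cp_zero)
next
  fix x y assume "x \<in> HQ" "y \<in> HQ"
  then show "x + y \<in> HQ" by (auto simp: HQ_def cp_add intro!: D_add)
next
  fix x assume "x \<in> HQ"
  then show "- x \<in> HQ" by (auto simp: HQ_def cp_uminus intro!: D_minus)
next
  fix x \<alpha> assume "x \<in> HQ"
  then show "rmH x \<alpha> \<in> HQ"
    unfolding HQ_def cp_rmH mem_Collect_eq by (intro conjI D_combination) auto
qed (auto simp: rmH_def fun_eq_iff algebra_simps)

lemma qip_self:
  assumes "g \<in> HQ"
  shows "qip g g = of_real (Q (cp qRe g) + Q (cp qI g) + Q (cp qJ g) + Q (cp qK g))"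
  using HQ_D [OF assms] by (simp add: qip_def Let_def of_real_quat R_self R_commute)

lemma ip_norm_qip:
  assumes "g \<in> HQ"
  shows "(ip_norm qip g)\<^sup>2 = Q (cp qRe g) + Q (cp qI g) + Q (cp qJ g) + Q (cp qK g)"
  using HQ_D [OF assms] by (simp add: ip_norm_def qip_self [OF assms] Q_nonneg del: of_real_add)

lemma HQ_eq_0:
  assumes "g \<in> HQ" "ip_norm qip g = 0"
  shows "g = 0"
proof -
  have "Q (cp qRe g) = 0" "Q (cp qI g) = 0" "Q (cp qJ g) = 0" "Q (cp qK g) = 0"
    using ip_norm_qip [OF assms(1)] assms(2) HQ_D [OF assms(1), THEN Q_nonneg] by auto
  then have "cp qRe g = (\<lambda>x. 0)" "cp qI g = (\<lambda>x. 0)" "cp qJ g = (\<lambda>x. 0)" "cp qK g = (\<lambda>x. 0)"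
    using Q_eq_0_iff HQ_D [OF assms(1)] by blast+
  then show ?thesis
    by (auto simp: cp_def fun_eq_iff quat_eq_iff zero_quat_def)
qed

lemma H_inner_product_HQ: "H_inner_product HQ rmH qip"
proof (intro H_inner_product.intro H_inner_product_axioms.intro right_H_module_HQ)
  fix x y z \<beta> assume "x \<in> HQ" "y \<in> HQ" "z \<in> HQ"
  note D = HQ_D [OF this(1)] HQ_D [OF this(2)] HQ_D [OF this(3)]
  have R: "R G (cp qRe (y + rmH z \<beta>)) = R G (cp qRe y) + (qRe \<beta> * R G (cp qRe z)
        + (- qI \<beta>) * R G (cp qI z) + (- qJ \<beta>) * R G (cp qJ z) + (- qK \<beta>) * R G (cp qK z))"
      "R G (cp qI (y + rmH z \<beta>)) = R G (cp qI y) + (qI \<beta> * R G (cp qRe z)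
        + qRe \<beta> * R G (cp qI z) + qK \<beta> * R G (cp qJ z) + (- qJ \<beta>) * R G (cp qK z))"
      "R G (cp qJ (y + rmH z \<beta>)) = R G (cp qJ y) + (qJ \<beta> * R G (cp qRe z)
        + (- qK \<beta>) * R G (cp qI z) + qRe \<beta> * R G (cp qJ z) + qI \<beta> * R G (cp qK z))"
      "R G (cp qK (y + rmH z \<beta>)) = R G (cp qK y) + (qK \<beta> * R G (cp qRe z)
        + qJ \<beta> * R G (cp qI z) + (- qI \<beta>) * R G (cp qJ z) + qRe \<beta> * R G (cp qK z))"
    if "G \<in> D" for G
    unfolding cp_rmH cp_add [OF insertI1] cp_add [OF insertI2 [OF insertI1]]
      cp_add [OF insertI2 [OF insertI2 [OF insertI1]]]
      cp_add [OF insertI2 [OF insertI2 [OF insertI2 [OF insertI1]]]]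
    by (rule R_combination [OF that D(5) D(9-12)] R_combination [OF that D(6) D(9-12)]
        R_combination [OF that D(7) D(9-12)] R_combination [OF that D(8) D(9-12)])+
  show "qip x (y + rmH z \<beta>) = qip x y + qip x z * \<beta>"
    using D(1-4) unfolding qip_def Let_def
    by (simp add: R quat_arith algebra_simps)
next
  fix x y assume "x \<in> HQ" "y \<in> HQ"
  note D = HQ_D [OF this(1)] HQ_D [OF this(2)]
  show "qip y x = qcnj (qip x y)"
    unfolding qip_def Let_def
    by (simp add: quat_arith R_commute [OF D(1)] R_commute [OF D(2)] R_commute [OF D(3)]
        R_commute [OF D(4)] D)
next
  fix x assume x: "x \<in> HQ"
  then show "\<exists>r\<ge>0. qip x x = of_real r"
    using qip_self [OF x] HQ_D [OF x] by (metis Q_nonneg add_nonneg_nonneg)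
  assume "qip x x = 0"
  then show "x = 0"
    using HQ_eq_0 [OF x] by (simp add: ip_norm_def)
qed

lemma nu_cp_le_ip_norm:
  assumes "g \<in> HQ" "f \<in> {qRe, qI, qJ, qK}"
  shows "nu (cp f g) \<le> ip_norm qip g"
proof (rule power2_le_imp_le)
  show "(nu (cp f g))\<^sup>2 \<le> (ip_norm qip g)\<^sup>2"
    using assms HQ_D [OF assms(1)] by (auto simp: ip_norm_qip Q_nonneg)
  show "0 \<le> ip_norm qip g"
    by (simp add: ip_norm_def)
qed

lemma HQ_complete:
  assumes s: "\<And>n. s n \<in> HQ"
    and cauchy: "\<And>e. e > 0 \<Longrightarrow> \<exists>N. \<forall>m\<ge>N. \<forall>n\<ge>N. ip_norm qip (s m - s n) < e"
  shows "\<exists>l\<in>HQ. (\<lambda>n. ip_norm qip (s n - l)) \<longlonglongrightarrow> 0"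
proof -
  have ex: "\<exists>F\<in>D. (\<lambda>n. nu (\<lambda>x. cp f (s n) x - F x)) \<longlonglongrightarrow> 0"
    if f: "f \<in> {qRe, qI, qJ, qK}" for f
  proof (rule D_complete)
    show "cp f (s n) \<in> D" for n
      using f HQ_D [OF s] by auto
    fix e :: real assume "e > 0"
    then obtain N where N: "\<And>m n. m \<ge> N \<Longrightarrow> n \<ge> N \<Longrightarrow> ip_norm qip (s m - s n) < e"
      using cauchy by blast
    have "nu (\<lambda>x. cp f (s m) x - cp f (s n) x) < e" if "m \<ge> N" "n \<ge> N" for m n
      using nu_cp_le_ip_norm [OF HQ_diff [OF s s] f, of m n] N [OF that]
      by (simp add: cp_diff [OF f])
    then show "\<exists>N. \<forall>m\<ge>N. \<forall>n\<ge>N. nu (\<lambda>x. cp f (s m) x - cp f (s n) x) < e"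
      by blast
  qed
  obtain F0 F1 F2 F3 where F: "F0 \<in> D" "F1 \<in> D" "F2 \<in> D" "F3 \<in> D"
    and lim: "(\<lambda>n. nu (\<lambda>x. cp qRe (s n) x - F0 x)) \<longlonglongrightarrow> 0"
      "(\<lambda>n. nu (\<lambda>x. cp qI (s n) x - F1 x)) \<longlonglongrightarrow> 0"
      "(\<lambda>n. nu (\<lambda>x. cp qJ (s n) x - F2 x)) \<longlonglongrightarrow> 0"
      "(\<lambda>n. nu (\<lambda>x. cp qK (s n) x - F3 x)) \<longlonglongrightarrow> 0"
    using ex [of qRe] ex [of qI] ex [of qJ] ex [of qK] by auto
  define l where "l i b = Quat (F0 (i, b)) (F1 (i, b)) (F2 (i, b)) (F3 (i, b))" for i b
  have cp_l: "cp qRe l = F0" "cp qI l = F1" "cp qJ l = F2" "cp qK l = F3"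
    by (auto simp: cp_def l_def)
  have l: "l \<in> HQ"
    using F by (simp add: HQ_def cp_l)
  have "(ip_norm qip (s n - l))\<^sup>2 =
    (nu (\<lambda>x. cp qRe (s n) x - F0 x))\<^sup>2 + (nu (\<lambda>x. cp qI (s n) x - F1 x))\<^sup>2 +
    (nu (\<lambda>x. cp qJ (s n) x - F2 x))\<^sup>2 + (nu (\<lambda>x. cp qK (s n) x - F3 x))\<^sup>2" for n
    using F HQ_D [OF s] by (simp add: ip_norm_qip HQ_diff [OF s l] cp_diff cp_l Q_nonneg D_diff)
  then have "(\<lambda>n. (ip_norm qip (s n - l))\<^sup>2) \<longlonglongrightarrow> 0\<^sup>2 + 0\<^sup>2 + 0\<^sup>2 + 0\<^sup>2"
    by (simp only:) (intro tendsto_intros lim)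
  then have "(\<lambda>n. sqrt ((ip_norm qip (s n - l))\<^sup>2)) \<longlonglongrightarrow> sqrt 0"
    by (intro tendsto_real_sqrt) simp
  then have "(\<lambda>n. ip_norm qip (s n - l)) \<longlonglongrightarrow> 0"
    by (simp add: ip_norm_def)
  with l show ?thesis by blast
qed

definition shift :: "('b \<Rightarrow> 'b) \<Rightarrow> ('i \<Rightarrow> 'b \<Rightarrow> quat) \<Rightarrow> 'i \<Rightarrow> 'b \<Rightarrow> quat"
  where "shift \<tau> g = (\<lambda>i b. g i (\<tau> b))"

lemma cp_shift: "cp f (shift \<tau> g) = (\<lambda>x. cp f g (map_prod id \<tau> x))"
  by (auto simp: cp_def shift_def)

lemma
  assumes "dominated (map_prod id \<tau>) M" "g \<in> HQ"
  shows shift_closed: "shift \<tau> g \<in> HQ"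
    and ip_norm_shift: "ip_norm qip (shift \<tau> g) \<le> M * ip_norm qip g"
proof -
  note D = HQ_D [OF assms(2)]
  show *: "shift \<tau> g \<in> HQ"
    using D D_comp [OF assms(1)] by (simp add: HQ_def cp_shift)
  have M: "M \<ge> 0"
    using assms(1) by (simp add: dominated_def)
  have Q: "Q (cp f (shift \<tau> g)) \<le> M\<^sup>2 * Q (cp f g)" if "f \<in> {qRe, qI, qJ, qK}" for f
  proof -
    have f: "cp f g \<in> D" using D that by auto
    show ?thesis
      using power_mono [OF nu_comp_le [OF assms(1) f], of 2]
      by (simp add: cp_shift power_mult_distrib Q_nonneg f D_comp [OF assms(1)])
  qed
  show "ip_norm qip (shift \<tau> g) \<le> M * ip_norm qip g"
  proof (rule power2_le_imp_le)
    show "(ip_norm qip (shift \<tau> g))\<^sup>2 \<le> (M * ip_norm qip g)\<^sup>2"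
      using Q [of qRe] Q [of qI] Q [of qJ] Q [of qK]
      by (simp add: ip_norm_qip * assms(2) power_mult_distrib algebra_simps)
    show "0 \<le> M * ip_norm qip g"
      using M by (simp add: ip_norm_def)
  qed
qed

lemma qip_shift_adjoint:
  assumes \<tau>: "dominated (map_prod id \<tau>) M" and \<sigma>: "dominated (map_prod id \<sigma>) N"
    and adj: "\<And>x y. K (map_prod id \<tau> x) y = K x (map_prod id \<sigma> y)"
    and g: "g \<in> HQ" and h: "h \<in> HQ"
  shows "qip (shift \<tau> g) h = qip g (shift \<sigma> h)"
  using HQ_D [OF g] HQ_D [OF h]
  by (simp add: qip_def Let_def cp_shift R_comp_adjoint [OF \<tau> \<sigma> adj])

text \<open>The real kernel functions, viewed as quaternion-valued functions.\<close>

definition kq :: "'i \<Rightarrow> 'b \<Rightarrow> 'i \<Rightarrow> 'b \<Rightarrow> quat"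
  where "kq i b = (\<lambda>j c. of_real (K (j, c) (i, b)))"

lemma kq_HQ: "kq i b \<in> HQ"
  and ip_norm_kq: "(ip_norm qip (kq i b))\<^sup>2 = K (i, b) (i, b)"
proof -
  have c: "cp qRe (kq i b) = kf [(1, (i, b))]" "cp qI (kq i b) = (\<lambda>x. 0)"
      "cp qJ (kq i b) = (\<lambda>x. 0)" "cp qK (kq i b) = (\<lambda>x. 0)"
    by (auto simp: cp_def kq_def of_real_quat kf_def fun_eq_iff)
  show *: "kq i b \<in> HQ"
    by (simp add: HQ_def c D_kf)
  have "Q (kf [(1, (i, b))]) = K (i, b) (i, b)"
    using Q_add_kf [OF D_zero, of "[(1, (i, b))]"] by (simp add: B_def kf_def [abs_def])
  then show "(ip_norm qip (kq i b))\<^sup>2 = K (i, b) (i, b)"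
    by (simp add: ip_norm_qip [OF *] c)
qed

end

section \<open>The complex subalgebra and its polynomial calculus\<close>

definition quat_i :: quat where "quat_i = Quat 0 1 0 0"
definition quat_j :: quat where "quat_j = Quat 0 0 1 0"

lemma quat_i_squared: "quat_i * quat_i = - 1"
  and quat_j_squared: "quat_j * quat_j = - 1"
  and quat_ji: "quat_j * quat_i = - (quat_i * quat_j)"
  and qcnj_quat_i: "qcnj quat_i = - quat_i"
  and qcnj_quat_j: "qcnj quat_j = - quat_j"
  by (simp_all add: quat_i_def quat_j_def qcnj_def times_quat_def uminus_quat_def one_quat_def)

lemma norm_quat_i [simp]: "norm quat_i = 1"
  and norm_quat_j [simp]: "norm quat_j = 1"
  by (simp_all add: quat_i_def quat_j_def norm_quat_def inner_quat_def)

lemma of_real_quat_commute: "of_real r * (q::quat) = q * of_real r"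
  by (simp add: of_real_def)

context H_Bstar_algebra
begin

lemma lmul_one' [simp]: "lmul 1 x = x"
  and rmul_one' [simp]: "rmul x 1 = x"
  and lmul_lmul': "lmul \<alpha> (lmul \<beta> x) = lmul (\<alpha> * \<beta>) x"
  and rmul_rmul': "rmul (rmul x \<alpha>) \<beta> = rmul x (\<alpha> * \<beta>)"
  and lmul_rmul': "rmul (lmul \<alpha> x) \<beta> = lmul \<alpha> (rmul x \<beta>)"
  and lmul_add: "lmul \<alpha> (x + y) = lmul \<alpha> x + lmul \<alpha> y"
  and lmul_add': "lmul (\<alpha> + \<beta>) x = lmul \<alpha> x + lmul \<beta> x"
  and rmul_add: "rmul (x + y) \<alpha> = rmul x \<alpha> + rmul y \<alpha>"
  by (simp_all add: lmul_one rmul_one lmul_lmul rmul_rmul lmul_rmul lmul_add_left lmul_add_right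
      rmul_add_left)

lemma rmul_of_real: "rmul x (of_real r) = r *\<^sub>R x"
  using real_central [of x r] lmul_of_real [of r x] by simp

lemma lmul_scaleR: "lmul \<alpha> (r *\<^sub>R x) = r *\<^sub>R lmul \<alpha> x"
  by (simp add: lmul_lmul' of_real_quat_commute flip: lmul_of_real)

lemma rmul_scaleR: "rmul (r *\<^sub>R x) \<alpha> = r *\<^sub>R rmul x \<alpha>"
  by (simp add: rmul_rmul' of_real_quat_commute flip: rmul_of_real)

lemma lmul_minus: "lmul \<alpha> (- x) = - lmul \<alpha> x" and rmul_minus: "rmul (- x) \<alpha> = - rmul x \<alpha>"
  and star_minus: "star (- x) = - star x"
  using lmul_scaleR [of \<alpha> "-1" x] rmul_scaleR [of "-1" x \<alpha>] star_scaleR [of "-1" x] by simp_all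

lemma lmul_minus': "lmul (- \<alpha>) x = - lmul \<alpha> x" and rmul_minus': "rmul x (- \<alpha>) = - rmul x \<alpha>"
proof -
  have "lmul (\<alpha> * of_real (-1)) x = - lmul \<alpha> x"
    by (simp only: lmul_lmul' [symmetric] lmul_of_real) (simp add: lmul_minus)
  then show "lmul (- \<alpha>) x = - lmul \<alpha> x" by simp
  have "rmul x (of_real (-1) * \<alpha>) = - rmul x \<alpha>"
    by (simp only: rmul_rmul' [symmetric] rmul_of_real) (simp add: rmul_minus)
  then show "rmul x (- \<alpha>) = - rmul x \<alpha>" by simp
qed

lemma lmul_diff: "lmul \<alpha> (x - y) = lmul \<alpha> x - lmul \<alpha> y"
  and rmul_diff: "rmul (x - y) \<alpha> = rmul x \<alpha> - rmul y \<alpha>"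
  and star_diff: "star (x - y) = star x - star y"
  using lmul_add [of \<alpha> x "- y"] rmul_add [of x "- y" \<alpha>] star_add [of x "- y"]
  by (simp_all add: lmul_minus rmul_minus star_minus)

lemma star_zero [simp]: "star 0 = 0"
  using star_scaleR [of 0 0] by simp

lemma norm_star [simp]: "norm (star a) = norm a"
proof -
  have "norm a \<le> norm (star a)" for a
  proof (cases "a = 0")
    case False
    have "norm a * norm a \<le> norm (star a) * norm a"
      using Bstar_identity [of a] norm_mult_ineq [of "star a" a] by (simp add: power2_eq_square)
    then show ?thesis using False by simp
  qed simp
  from this [of a] this [of "star a"] show ?thesis by (simp add: star_star)
qed

lemma Bstar_identity': "norm (a * star a) = (norm a)\<^sup>2"
  using Bstar_identity [of "star a"] by (simp add: star_star)

lemma norm_lmul_le: "norm (lmul \<alpha> x) \<le> norm \<alpha> * norm x"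
  and norm_rmul_le: "norm (rmul x \<beta>) \<le> norm x * norm \<beta>"
  using norm_lmul_rmul_le [of \<alpha> x 1] norm_lmul_rmul_le [of 1 x \<beta>] by simp_all

text \<open>
  The elements that commute with the quaternion unit \<open>i\<close> form a complex algebra with scalar
  \<open>i\<close>, and the involution is conjugate linear on it.
\<close>

definition BC :: "'a set" where "BC = {x. lmul quat_i x = rmul x quat_i}"

definition SA :: "'a set" where "SA = {x \<in> BC. star x = x}"

lemma BC_D: "x \<in> BC \<Longrightarrow> rmul x quat_i = lmul quat_i x"
  by (simp add: BC_def)

lemma BC_times_i: "x \<in> BC \<Longrightarrow> x * lmul quat_i b = lmul quat_i (x * b)"
  by (simp add: BC_D lmul_times flip: rmul_times)

lemma BC_add: "x \<in> BC \<Longrightarrow> y \<in> BC \<Longrightarrow> x + y \<in> BC"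
  and BC_diff: "x \<in> BC \<Longrightarrow> y \<in> BC \<Longrightarrow> x - y \<in> BC"
  and BC_minus: "x \<in> BC \<Longrightarrow> - x \<in> BC"
  and BC_scaleR: "x \<in> BC \<Longrightarrow> r *\<^sub>R x \<in> BC"
  by (simp_all add: BC_def lmul_add rmul_add lmul_diff rmul_diff lmul_minus rmul_minus
      lmul_scaleR rmul_scaleR)

lemma BC_mult: "x \<in> BC \<Longrightarrow> y \<in> BC \<Longrightarrow> x * y \<in> BC"
  by (simp add: BC_def times_rmul BC_times_i flip: lmul_times) (metis lmul_times rmul_times)

lemma BC_star: "x \<in> BC \<Longrightarrow> star x \<in> BC"
proof -
  assume "x \<in> BC"
  then have "star (lmul quat_i x) = star (rmul x quat_i)" by (simp add: BC_def)
  then show "star x \<in> BC"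
    by (simp add: BC_def star_lmul star_rmul qcnj_quat_i lmul_minus' rmul_minus')
qed

lemma SA_BC: "x \<in> SA \<Longrightarrow> x \<in> BC" and SA_star: "x \<in> SA \<Longrightarrow> star x = x"
  by (simp_all add: SA_def)

lemma SA_minus: "x \<in> SA \<Longrightarrow> - x \<in> SA"
  by (simp add: SA_def BC_minus star_minus)

lemma SA_square: "x \<in> SA \<Longrightarrow> x * x \<in> SA"
  by (simp add: SA_def BC_mult star_times)

lemma SA_star_times: "y \<in> BC \<Longrightarrow> star y * y \<in> SA" and SA_times_star: "y \<in> BC \<Longrightarrow> y * star y \<in> SA"
  by (simp_all add: SA_def BC_mult BC_star star_times star_star)

text \<open>
  A real polynomial in \<open>x\<close> acts on the algebra by left multiplication, whether or not there is a
  unit to carry its constant term.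
\<close>

definition pact :: "'a \<Rightarrow> real poly \<Rightarrow> 'a \<Rightarrow> 'a"
  where "pact x f = fold_coeffs (\<lambda>c F b. c *\<^sub>R b + x * F b) f (\<lambda>b. 0)"

lemma pact_0 [simp]: "pact x 0 b = 0"
  by (simp add: pact_def)

lemma pact_pCons [simp]: "pact x (pCons c f) b = c *\<^sub>R b + x * pact x f b"
  by (cases "f = 0 \<and> c = 0") (auto simp: pact_def)

lemma pact_1 [simp]: "pact x 1 b = b"
  by (simp add: one_pCons)

lemma pact_add: "pact x (f + g) b = pact x f b + pact x g b"
  by (induction f g rule: poly_induct2) (simp_all add: algebra_simps)

lemma pact_smult: "pact x (smult c f) b = c *\<^sub>R pact x f b"
  by (induction f) (simp_all add: algebra_simps)

lemma pact_diff: "pact x (f - g) b = pact x f b - pact x g b"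
  using pact_add [of x f "smult (-1) g" b] pact_smult [of x "-1" g b] by simp

lemma bounded_linear_pact: "bounded_linear (pact x f)"
proof (induction f)
  case 0
  then show ?case
    using bounded_linear_zero by (simp add: pact_def)
next
  case (pCons c f)
  have "bounded_linear (\<lambda>b. c *\<^sub>R b + x * pact x f b)"
    by (intro bounded_linear_add bounded_linear_scaleR_right
        bounded_linear_compose [OF bounded_linear_mult_right pCons.IH])
  moreover have "pact x (pCons c f) = (\<lambda>b. c *\<^sub>R b + x * pact x f b)"
    by (simp add: fun_eq_iff)
  ultimately show ?case by simp
qed

lemma pact_mult: "pact x (f * g) b = pact x f (pact x g b)"
  by (induction f) (simp_all add: pact_add pact_smult)

lemma pact_commute: "pact x f (pact x g b) = pact x g (pact x f b)"
  by (metis pact_mult mult.commute)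

lemma pact_lmul_i: "x \<in> BC \<Longrightarrow> pact x f (lmul quat_i b) = lmul quat_i (pact x f b)"
proof (induction f)
  case 0
  then show ?case using lmul_scaleR [of quat_i 0 0] by simp
qed (simp add: lmul_add lmul_scaleR BC_times_i)

lemma pact_adjoint:
  assumes "star x = x"
  shows "star (pact x f a) * b = star a * pact x f b"
proof (induction f arbitrary: a b)
  case (pCons c f)
  have "pact x f (x * b) = x * pact x f b"
    using pact_commute [of x f "[:0, 1:]" b] by simp
  then show ?case
    using pCons.IH [of a "x * b"]
    by (simp add: star_add star_scaleR star_times assms algebra_simps)
qed simp

text \<open>
  Here the complex structure enters. For \<open>u = f(x) b + i w(x) b\<close> the cross terms of \<open>star u * u\<close>
  cancel, so \<open>star u * u\<close> is \<open>star b * (f\<^sup>2 + w\<^sup>2)(x) b\<close>. This fails for real algebras in general: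
  with the trivial involution on the complex numbers, the square of a self-adjoint element may be
  negative.
\<close>

lemma norm_pact_le_sum_squares:
  assumes "x \<in> SA"
  shows "(norm (pact x f b))\<^sup>2 \<le> norm b * norm (pact x (f * f + w * w) b)"
proof -
  define c d where "c = pact x f b" and "d = pact x w b"
  define P where "P = pact x (f * f + w * w) b"
  have x: "x \<in> BC" "star x = x" using assms by (auto simp: SA_def)
  have cc: "star c * c = star b * pact x (f * f) b" and dd: "star d * d = star b * pact x (w * w) b"
    by (simp_all add: c_def d_def pact_adjoint [OF x(2)] pact_mult)
  have cross: "star c * lmul quat_i d = star d * lmul quat_i c"
    by (simp add: c_def d_def pact_adjoint [OF x(2)] pact_lmul_i [OF x(1)] pact_commute [of x f w])
  have ii: "lmul quat_i (lmul quat_i d) = - d"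
    by (simp add: lmul_lmul' quat_i_squared lmul_minus')
  have u: "norm (c + s *\<^sub>R lmul quat_i d) \<le> sqrt (norm b * norm P)" if s: "s * s = 1" for s
  proof -
    define u where "u = c + s *\<^sub>R lmul quat_i d"
    have su: "star u = star c - s *\<^sub>R rmul (star d) quat_i"
      by (simp add: u_def star_add star_scaleR star_lmul qcnj_quat_i rmul_minus')
    have "star u * u = (star c - s *\<^sub>R rmul (star d) quat_i) * (c + s *\<^sub>R lmul quat_i d)"
      unfolding su unfolding u_def ..
    also have "\<dots> = star c * c + star d * d"
      using s by (simp add: algebra_simps rmul_times ii cross)
    finally have "star u * u = star c * c + star d * d" .
    then have "star u * u = star b * P"
      by (simp add: cc dd P_def pact_add algebra_simps)
    then have "(norm u)\<^sup>2 = norm (star b * P)"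
      using Bstar_identity [of u] by simp
    also have "\<dots> \<le> norm b * norm P"
      using norm_mult_ineq [of "star b" P] by simp
    finally show ?thesis
      using real_le_rsqrt by (simp add: u_def)
  qed
  have "norm (2 *\<^sub>R c) \<le> norm (c + 1 *\<^sub>R lmul quat_i d) + norm (c + (-1) *\<^sub>R lmul quat_i d)"
    using norm_triangle_ineq [of "c + lmul quat_i d" "c - lmul quat_i d"] by (simp add: scaleR_2)
  then have "norm c \<le> sqrt (norm b * norm P)"
    using u [of 1] u [of "-1"] by simp
  then have "(norm c)\<^sup>2 \<le> (sqrt (norm b * norm P))\<^sup>2"
    by (rule power_mono) simp
  then show ?thesis by (simp add: c_def P_def)
qed

definition pn :: "'a \<Rightarrow> real poly \<Rightarrow> real"
  where "pn x f = onorm (pact x f)"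

lemma pact_le: "norm (pact x f b) \<le> pn x f * norm b"
  unfolding pn_def by (rule onorm [OF bounded_linear_pact])

lemma pn_nonneg [simp]: "0 \<le> pn x f"
  unfolding pn_def by (rule onorm_pos_le [OF bounded_linear_pact])

lemma pn_leI: "(\<And>b. norm (pact x f b) \<le> C * norm b) \<Longrightarrow> C \<ge> 0 \<Longrightarrow> pn x f \<le> C"
  unfolding pn_def by (rule onorm_bound)

lemma pn_mult_le: "pn x (f * g) \<le> pn x f * pn x g"
proof (rule pn_leI)
  fix b
  have "norm (pact x (f * g) b) \<le> pn x f * norm (pact x g b)"
    using pact_le [of x f "pact x g b"] by (simp add: pact_mult)
  also have "\<dots> \<le> pn x f * (pn x g * norm b)"
    by (intro mult_left_mono pact_le) simp
  finally show "norm (pact x (f * g) b) \<le> pn x f * pn x g * norm b"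
    by (simp add: mult.assoc)
qed simp

lemma pn_add_le: "pn x (f + g) \<le> pn x f + pn x g"
proof (rule pn_leI)
  fix b
  show "norm (pact x (f + g) b) \<le> (pn x f + pn x g) * norm b"
    using norm_triangle_ineq [of "pact x f b" "pact x g b"] pact_le [of x f b] pact_le [of x g b]
    by (simp add: pact_add algebra_simps)
qed simp

lemma pn_smult: "pn x (smult c f) = \<bar>c\<bar> * pn x f"
proof -
  have "pact x (smult c f) = (\<lambda>b. c *\<^sub>R pact x f b)"
    by (simp add: pact_smult fun_eq_iff)
  then show ?thesis
    by (simp add: pn_def onorm_scaleR [OF bounded_linear_pact])
qed

lemma pn_sum_squares:
  assumes "x \<in> SA"
  shows "(pn x f)\<^sup>2 \<le> pn x (f * f + w * w)"
proof -
  let ?n = "pn x (f * f + w * w)"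
  have "pn x f \<le> sqrt ?n"
  proof (rule pn_leI)
    fix b
    have "(norm (pact x f b))\<^sup>2 \<le> norm b * (?n * norm b)"
      using norm_pact_le_sum_squares [OF assms, of f b w] pact_le [of x "f * f + w * w" b]
      by (meson mult_left_mono norm_ge_zero order_trans)
    also have "\<dots> = (sqrt ?n * norm b)\<^sup>2"
      by (simp add: power_mult_distrib power2_eq_square [of "norm b"])
    finally show "norm (pact x f b) \<le> sqrt ?n * norm b"
      by (rule power2_le_imp_le) simp
  qed simp
  then have "(pn x f)\<^sup>2 \<le> (sqrt ?n)\<^sup>2"
    by (rule power_mono) simp
  then show ?thesis by simp
qed

lemma pn_square: "x \<in> SA \<Longrightarrow> pn x (f * f) = (pn x f)\<^sup>2"
  using pn_sum_squares [of x f 0] pn_mult_le [of x f f]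
  by (intro antisym) (simp_all add: power2_eq_square)

text \<open>
  Monotonicity of the norm with a cofactor \<open>g\<close> of any sign: both \<open>(f\<^sup>2 - w\<^sup>2) g\<close> and \<open>2 f w g\<close> are
  dominated by \<open>(f\<^sup>2 + w\<^sup>2) g\<close>, because their squares add up to its square.
\<close>

lemma pn_monotone:
  assumes "x \<in> SA"
  shows "pn x (f * f * g) \<le> pn x ((f * f + w * w) * g)"
proof -
  let ?s = "(f * f + w * w) * g" and ?d = "(f * f - w * w) * g"
  have two: "smult 2 p = p + p" for p :: "real poly"
    using smult_add_left [of 1 1 p] by simp
  have "?d * ?d + (smult 2 (f * w * g)) * (smult 2 (f * w * g)) = ?s * ?s"
    unfolding two by (simp add: algebra_simps)
  then have "(pn x ?d)\<^sup>2 \<le> pn x (?s * ?s)"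
    using pn_sum_squares [OF assms, of ?d "smult 2 (f * w * g)"] by simp
  also have "\<dots> = (pn x ?s)\<^sup>2"
    by (rule pn_square [OF assms])
  finally have d: "pn x ?d \<le> pn x ?s"
    by (rule power2_le_imp_le) simp
  have "smult 2 (f * f * g) = ?d + ?s"
    unfolding two by (simp add: algebra_simps)
  then have "2 * pn x (f * f * g) \<le> pn x ?d + pn x ?s"
    using pn_smult [of x 2 "f * f * g"] pn_add_le [of x ?d ?s] by simp
  then show ?thesis using d by simp
qed

end

section \<open>Approximate eigenvalues\<close>

definition approx_eigenvalue :: "('a::real_normed_vector \<Rightarrow> 'a) \<Rightarrow> real \<Rightarrow> bool"
  where "approx_eigenvalue T l \<longleftrightarrow> (\<forall>e>0. \<exists>b. b \<noteq> 0 \<and> norm (T b - l *\<^sub>R b) \<le> e * norm b)"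

lemma approx_eigenvalueE:
  assumes "approx_eigenvalue T l" "e > 0"
  obtains b where "b \<noteq> 0" "norm (T b - l *\<^sub>R b) \<le> e * norm b"
  using assms unfolding approx_eigenvalue_def by blast

lemma not_approx_eigenvalueE:
  assumes "\<not> approx_eigenvalue T l"
  obtains e where "e > 0" "\<And>b. e * norm b \<le> norm (T b - l *\<^sub>R b)"
proof -
  obtain e where e: "e > 0" "\<And>b. b \<noteq> 0 \<Longrightarrow> e * norm b < norm (T b - l *\<^sub>R b)"
    using assms unfolding approx_eigenvalue_def by (auto simp: not_le)
  show thesis
  proof (rule that [OF e(1)])
    show "e * norm b \<le> norm (T b - l *\<^sub>R b)" for b
      using e(2) [of b] by (cases "b = 0") auto
  qed
qed

lemma approx_eigenvalue_uminus:
  "approx_eigenvalue T l \<Longrightarrow> approx_eigenvalue (\<lambda>b. - T b) (- l)"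
  unfolding approx_eigenvalue_def by (simp add: norm_minus_commute add.commute)

context H_Bstar_algebra
begin

text \<open>In particular, \<open>c + w(x)\<^sup>2\<close> is bounded below by \<open>c\<close>.\<close>

lemma norm_add_square_ge:
  assumes "x \<in> SA" "c \<ge> 0"
  shows "c * norm b \<le> norm (pact x ([:c:] + w * w) b)"
proof (cases "b = 0")
  case False
  have "(sqrt c * norm b)\<^sup>2 \<le> norm b * norm (pact x ([:c:] + w * w) b)"
    using norm_pact_le_sum_squares [OF assms(1), of "[:sqrt c:]" b w] assms(2) by simp
  then have "norm b * (c * norm b) \<le> norm b * norm (pact x ([:c:] + w * w) b)"
    using assms(2) by (simp add: power_mult_distrib power2_eq_square [of "norm b"] mult_ac)
  then show ?thesis
    using False by simp
qed simp

text \<open>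
  The averages \<open>(1 + t) (1 + t\<^sup>2) (1 + t\<^sup>4) \<dots> / 2\<^sup>k\<close> of the powers of \<open>t = f\<^sup>4\<close>: multiplication by
  \<open>1 - t\<close> makes them small, but they dominate a power of \<open>f\<close>, which has norm one. So their range
  contains approximate eigenvectors of \<open>t\<close> for the eigenvalue one.
\<close>

definition averages :: "real poly \<Rightarrow> nat \<Rightarrow> real poly"
  where "averages f k = (\<Prod>i<k. smult (1/2) (1 + f ^ (4 * 2 ^ i)))"

lemma averages_Suc: "averages f (Suc k) = averages f k * smult (1/2) (1 + f ^ (4 * 2 ^ k))"
  by (simp add: averages_def)

lemma averages_telescope:
  "(1 - f ^ 4) * averages f k = smult (1 / 2 ^ k) (1 - f ^ (4 * 2 ^ k))"
proof (induction k)
  case (Suc k)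
  have "(1 - f ^ 4) * averages f (Suc k)
      = smult (1 / 2 ^ k) (1 - f ^ (4 * 2 ^ k)) * smult (1/2) (1 + f ^ (4 * 2 ^ k))"
    by (simp only: averages_Suc mult.assoc [symmetric] Suc.IH)
  also have "\<dots> = smult (1 / 2 ^ Suc k) ((1 - f ^ (4 * 2 ^ k)) * (1 + f ^ (4 * 2 ^ k)))"
    by (simp add: mult.commute)
  also have "(1 - f ^ (4 * 2 ^ k)) * (1 + f ^ (4 * 2 ^ k)) = 1 - f ^ (4 * 2 ^ Suc k)"
    by (simp add: algebra_simps flip: power_add)
  finally show ?case .
qed (simp add: averages_def)

lemma averages_dominate:
  assumes "x \<in> SA"
  shows "pn x (f ^ (2 * (2 ^ k - 1)) * g) \<le> pn x (averages f k * g)"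
proof (induction k arbitrary: g)
  case (Suc k)
  define h where "h = f ^ 2 ^ k"
  define w where "w = smult (sqrt (1/2)) (1 - h * h)"
  have two: "smult (1/2) p + smult (1/2) p = p" for p :: "real poly"
    by (simp flip: smult_add_left)
  have hh: "h * h = f ^ (2 * 2 ^ k)" and h4: "h * h * (h * h) = f ^ (4 * 2 ^ k)"
  proof -
    have "2 ^ k + 2 ^ k = 2 * (2::nat) ^ k" "2 * 2 ^ k + 2 * 2 ^ k = 4 * (2::nat) ^ k" by simp_all
    then show "h * h = f ^ (2 * 2 ^ k)" "h * h * (h * h) = f ^ (4 * 2 ^ k)"
      by (simp_all only: h_def power_add [symmetric])
  qed
  have w: "w * w = smult (1/2) (1 + h * h * (h * h)) - h * h"
  proof -
    have "w * w = smult (1/2) ((1 - h * h) * (1 - h * h))"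
      by (simp add: w_def flip: real_sqrt_mult)
    also have "\<dots> = smult (1/2) (1 + h * h * (h * h)) - (smult (1/2) (h * h) + smult (1/2) (h * h))"
      by (simp add: algebra_simps smult_add_right smult_diff_right)
    finally show ?thesis by (simp only: two)
  qed
  have "2 * (2 ^ Suc k - 1) = 2 * (2 ^ k - 1) + 2 * (2::nat) ^ k"
    by (cases "(2::nat) ^ k") auto
  then have "pn x (f ^ (2 * (2 ^ Suc k - 1)) * g) = pn x (h * h * (f ^ (2 * (2 ^ k - 1)) * g))"
    by (simp only: hh power_add mult_ac)
  also have "\<dots> \<le> pn x ((h * h + w * w) * (f ^ (2 * (2 ^ k - 1)) * g))"
    by (rule pn_monotone [OF assms])
  also have "h * h + w * w = smult (1/2) (1 + f ^ (4 * 2 ^ k))"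
    using w h4 by simp
  also have "pn x (smult (1/2) (1 + f ^ (4 * 2 ^ k)) * (f ^ (2 * (2 ^ k - 1)) * g))
      = pn x (f ^ (2 * (2 ^ k - 1)) * (smult (1/2) (1 + f ^ (4 * 2 ^ k)) * g))"
    by (simp only: mult_ac)
  also have "\<dots> \<le> pn x (averages f k * (smult (1/2) (1 + f ^ (4 * 2 ^ k)) * g))"
    by (rule Suc.IH)
  finally show ?case
    by (simp only: averages_Suc mult.assoc)
qed (simp add: averages_def)

lemma pn_power_two: "x \<in> SA \<Longrightarrow> pn x f = 1 \<Longrightarrow> pn x (f ^ 2 ^ m) = 1"
proof (induction m)
  case (Suc m)
  have "f ^ 2 ^ Suc m = f ^ 2 ^ m * f ^ 2 ^ m"
    by (simp add: mult_2 flip: power_add)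
  then show ?case
    using Suc pn_square [of x "f ^ 2 ^ m"] by simp
qed simp

lemma approx_eigenvalue_unit_power:
  assumes x: "x \<in> SA" and f: "pn x f = 1" and e: "e > 0"
  obtains b where "b \<noteq> 0" "norm (pact x (1 - f ^ 4) b) \<le> e * norm b"
proof -
  obtain k :: nat where k: "4 / e < 2 ^ k"
    using real_arch_pow [of 2 "4 / e"] by auto
  have "f ^ 2 ^ Suc k = f ^ (2 * (2 ^ k - 1)) * (f * f)"
  proof -
    have "2 ^ Suc k = 2 * (2 ^ k - 1) + (1 + 1::nat)"
      by (cases "(2::nat) ^ k") auto
    then show ?thesis by (simp only: power_add power_one_right)
  qed
  then have "1 \<le> pn x (averages f k * (f * f))"
    using averages_dominate [OF x, of f k "f * f"] pn_power_two [OF x f, of "Suc k"] by simp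
  also have "\<dots> \<le> pn x (averages f k)"
    using pn_mult_le [of x "averages f k" "f * f"] pn_square [OF x, of f] f by simp
  finally have "\<not> pn x (averages f k) \<le> 1/2" by simp
  then obtain c where c: "1/2 * norm c < norm (pact x (averages f k) c)"
    using pn_leI [of x "averages f k" "1/2"] not_le by fastforce
  define b where "b = pact x (averages f k) c"
  have b: "b \<noteq> 0"
    using c by (auto simp: b_def)
  have "pact x (1 - f ^ 4) b = (1 / 2 ^ k) *\<^sub>R pact x (1 - f ^ (4 * 2 ^ k)) c"
    unfolding b_def pact_mult [symmetric] averages_telescope pact_smult ..
  moreover have "norm (pact x (1 - f ^ (4 * 2 ^ k)) c) \<le> 2 * norm c"
  proof -
    have "pn x (f ^ (4 * 2 ^ k)) = 1"
      using pn_power_two [OF x f, of "k + 2"] by (simp add: power_add mult.commute)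
    then show ?thesis
      using norm_triangle_ineq4 [of c "pact x (f ^ (4 * 2 ^ k)) c"] pact_le [of x "f ^ (4 * 2 ^ k)" c]
      by (simp add: pact_diff)
  qed
  ultimately have "norm (pact x (1 - f ^ 4) b) \<le> (4 / 2 ^ k) * (norm c / 2)"
    by (simp add: field_simps)
  also have "\<dots> \<le> e * norm b"
    using k e c by (intro mult_mono) (auto simp: b_def field_simps)
  finally have "norm (pact x (1 - f ^ 4) b) \<le> e * norm b" .
  with b show thesis by (rule that)
qed

text \<open>
  The norm of a self-adjoint operator is attained, up to sign, at an approximate eigenvalue:
  \<open>1 - f\<^sup>4 = (1 + f\<^sup>2) (1 - f) (1 + f)\<close>, and the first factor is bounded below.
\<close>

lemma approx_eigenvalue_norm:
  assumes x: "x \<in> SA" and pos: "pn x f > 0"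
  shows "approx_eigenvalue (pact x f) (pn x f) \<or> approx_eigenvalue (pact x f) (- pn x f)"
proof (rule ccontr)
  assume *: "\<not> ?thesis"
  define n g where "n = pn x f" and "g = smult (1 / n) f"
  have n: "n > 0" using pos by (simp add: n_def)
  have g: "pn x g = 1"
    using n by (simp add: g_def pn_smult n_def)
  have f: "pact x f b = n *\<^sub>R pact x g b" for b
    using n by (simp add: g_def pact_smult)
  obtain d where d: "d > 0" "\<And>b. d * norm b \<le> norm (pact x f b - n *\<^sub>R b)"
    using * not_approx_eigenvalueE unfolding n_def by metis
  obtain e where e: "e > 0" "\<And>b. e * norm b \<le> norm (pact x f b - (- n) *\<^sub>R b)"
    using * not_approx_eigenvalueE unfolding n_def by metis
  have d': "d / n * norm b \<le> norm (pact x (1 - g) b)" for b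
  proof -
    have "pact x f b - n *\<^sub>R b = (- n) *\<^sub>R pact x (1 - g) b"
      by (simp add: f pact_diff algebra_simps)
    then have "norm (pact x f b - n *\<^sub>R b) = n * norm (pact x (1 - g) b)"
      using n by simp
    then show ?thesis using d(2) [of b] n by (simp add: field_simps)
  qed
  have e': "e / n * norm b \<le> norm (pact x (1 + g) b)" for b
  proof -
    have "pact x f b - (- n) *\<^sub>R b = n *\<^sub>R pact x (1 + g) b"
      by (simp add: f pact_add algebra_simps)
    then have "norm (pact x f b - (- n) *\<^sub>R b) = n * norm (pact x (1 + g) b)"
      using n by simp
    then show ?thesis using e(2) [of b] n by (simp add: field_simps)
  qed
  have one: "norm b \<le> norm (pact x (1 + g * g) b)" for b
    using norm_add_square_ge [OF x, of 1 b g] by (simp add: one_pCons)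
  define c where "c = d / n * (e / n)"
  have c: "c > 0" using d e n by (simp add: c_def)
  have low: "c * norm b \<le> norm (pact x (1 - g ^ 4) b)" for b
  proof -
    have "1 - g ^ 4 = (1 + g * g) * ((1 - g) * (1 + g))"
      by (simp add: algebra_simps eval_nat_numeral)
    then have "norm (pact x (1 - g) (pact x (1 + g) b)) \<le> norm (pact x (1 - g ^ 4) b)"
      using one by (simp add: pact_mult)
    moreover have "d / n * (e / n * norm b) \<le> d / n * norm (pact x (1 + g) b)"
      using d n by (intro mult_left_mono e') auto
    ultimately show ?thesis
      using d' [of "pact x (1 + g) b"] by (simp add: c_def mult.assoc)
  qed
  obtain b where b: "b \<noteq> 0" "norm (pact x (1 - g ^ 4) b) \<le> c / 2 * norm b"
    using approx_eigenvalue_unit_power [OF x g, of "c / 2"] c by auto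
  moreover have "c * norm b > 0"
    using b c by simp
  ultimately show False
    using low [of b] by simp
qed

lemma approx_eigenvalue_poly:
  fixes x :: 'a
  assumes "approx_eigenvalue (\<lambda>b. x * b) l"
  shows "approx_eigenvalue (pact x f) (poly f l)"
  unfolding approx_eigenvalue_def
proof (intro allI impI)
  fix e :: real assume e: "e > 0"
  have "[:- l, 1:] dvd f - [:poly f l:]"
    by (simp flip: poly_eq_0_iff_dvd)
  then obtain g where g: "f - [:poly f l:] = g * [:- l, 1:]"
    by (metis dvdE mult.commute)
  define c where "c = pn x g + 1"
  have c: "c > 0" by (simp add: c_def add_nonneg_pos)
  obtain b where b: "b \<noteq> 0" "norm (x * b - l *\<^sub>R b) \<le> e / c * norm b"
    using approx_eigenvalueE [OF assms, of "e / c"] e c by auto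
  have "pact x f b - poly f l *\<^sub>R b = pact x (f - [:poly f l:]) b"
    by (simp add: pact_diff)
  also have "\<dots> = pact x g (x * b - l *\<^sub>R b)"
    unfolding g pact_mult by (simp add: algebra_simps)
  finally have "norm (pact x f b - poly f l *\<^sub>R b) \<le> pn x g * norm (x * b - l *\<^sub>R b)"
    by (simp add: pact_le)
  also have "\<dots> \<le> c * (e / c * norm b)"
    using b c by (intro mult_mono) (auto simp: c_def)
  also have "\<dots> = e * norm b" using c by simp
  finally show "\<exists>b. b \<noteq> 0 \<and> norm (pact x f b - poly f l *\<^sub>R b) \<le> e * norm b"
    using b by blast
qed

lemma approx_eigenvalue_bound:
  fixes x :: 'a
  assumes "approx_eigenvalue (\<lambda>b. x * b) l"
  shows "\<bar>l\<bar> \<le> norm x"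
proof (rule field_le_epsilon)
  fix e :: real assume "e > 0"
  then obtain b where b: "b \<noteq> 0" "norm (x * b - l *\<^sub>R b) \<le> e * norm b"
    using approx_eigenvalueE [OF assms] by blast
  have "\<bar>l\<bar> * norm b \<le> norm (x * b) + norm (x * b - l *\<^sub>R b)"
    using norm_triangle_ineq4 [of "x * b" "x * b - l *\<^sub>R b"] by simp
  also have "\<dots> \<le> (norm x + e) * norm b"
    using b(2) norm_mult_ineq [of x b] by (simp add: algebra_simps)
  finally show "\<bar>l\<bar> \<le> norm x + e"
    using b(1) by simp
qed

lemma approx_eigenvalue_times_uminus:
  fixes x :: 'a
  shows "approx_eigenvalue (\<lambda>b. x * b) l \<Longrightarrow> approx_eigenvalue (\<lambda>b. - x * b) (- l)"
  using approx_eigenvalue_uminus [of "\<lambda>b. x * b" l] by simp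

text \<open>\<open>z\<close> maps approximate eigenvectors of \<open>star z * z\<close> to those of \<open>z * star z\<close>.\<close>

lemma approx_eigenvalue_swap:
  assumes ev: "approx_eigenvalue (\<lambda>b. star z * z * b) l" and l: "l \<noteq> 0"
  shows "approx_eigenvalue (\<lambda>b. z * star z * b) l"
  unfolding approx_eigenvalue_def
proof (intro allI impI)
  fix e :: real assume e: "e > 0"
  define m where "m = norm z + 1"
  have m: "m > 0" "norm z \<le> m" by (simp_all add: m_def add_nonneg_pos)
  define d where "d = min (\<bar>l\<bar> / 2) (e * \<bar>l\<bar> / (2 * m * m))"
  have d: "d > 0" "d \<le> \<bar>l\<bar> / 2" "d \<le> e * \<bar>l\<bar> / (2 * m * m)"
    using e l m by (auto simp: d_def)
  obtain b where b: "b \<noteq> 0" "norm (star z * z * b - l *\<^sub>R b) \<le> d * norm b"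
    using approx_eigenvalueE [OF ev d(1)] by blast
  have "\<bar>l\<bar> * norm b \<le> norm (star z * z * b) + norm (star z * z * b - l *\<^sub>R b)"
    using norm_triangle_ineq4 [of "star z * z * b" "star z * z * b - l *\<^sub>R b"] by simp
  moreover have "norm (star z * z * b) \<le> m * norm (z * b)"
  proof -
    have "norm (star z * (z * b)) \<le> norm z * norm (z * b)"
      using norm_mult_ineq [of "star z" "z * b"] by simp
    also have "\<dots> \<le> m * norm (z * b)" using m by (intro mult_right_mono) auto
    finally show ?thesis by (simp add: mult.assoc)
  qed
  moreover have "d * norm b \<le> \<bar>l\<bar> / 2 * norm b"
    using d by (intro mult_right_mono) auto
  ultimately have low: "\<bar>l\<bar> / 2 * norm b \<le> m * norm (z * b)"
    using b(2) by simp
  then have "z * b \<noteq> 0"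
    using b(1) l by (auto simp: mult_le_0_iff)
  moreover have "norm (z * star z * (z * b) - l *\<^sub>R (z * b)) \<le> e * norm (z * b)"
  proof -
    have "z * star z * (z * b) - l *\<^sub>R (z * b) = z * (star z * z * b - l *\<^sub>R b)"
      by (simp add: algebra_simps mult.assoc)
    then have "norm (z * star z * (z * b) - l *\<^sub>R (z * b)) \<le> norm z * norm (star z * z * b - l *\<^sub>R b)"
      by (simp add: norm_mult_ineq)
    also have "\<dots> \<le> m * (e * \<bar>l\<bar> / (2 * m * m) * norm b)"
      using m b(2) d by (intro mult_mono order_trans [OF b(2)] mult_right_mono) auto
    also have "\<dots> = e / m * (\<bar>l\<bar> / 2 * norm b)"
      using m by (simp add: field_simps)
    also have "\<dots> \<le> e / m * (m * norm (z * b))"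
      using e m low by (intro mult_left_mono) auto
    also have "\<dots> = e * norm (z * b)" using m by simp
    finally show ?thesis .
  qed
  ultimately show "\<exists>b. b \<noteq> 0 \<and> norm (z * star z * b - l *\<^sub>R b) \<le> e * norm b"
    by blast
qed

end

section \<open>Upper spectral bounds and positivity\<close>

text \<open>
  On the zero space every operator has norm zero, and the infimum that defines \<open>top_of\<close> below would be
  taken over a set without lower bound.
\<close>

locale nontrivial_H_Bstar_algebra = H_Bstar_algebra lmul rmul star
  for lmul :: "quat \<Rightarrow> 'a::{real_normed_algebra, banach} \<Rightarrow> 'a"
    and rmul :: "'a \<Rightarrow> quat \<Rightarrow> 'a"
    and star :: "'a \<Rightarrow> 'a" +
  assumes nontrivial: "\<exists>b::'a. b \<noteq> 0"
begin

text \<open>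
  \<open>shift_norm s x\<close> is the norm of \<open>s + x\<close> as a left multiplication. \<open>top_of x\<close> is the one-sided
  derivative of this norm at the identity in the direction \<open>x\<close>, the upper end of the numerical range
  of \<open>x\<close>. Being an infimum of shifted norms, it is sublinear on the whole algebra.
\<close>

definition shift_norm :: "real \<Rightarrow> 'a \<Rightarrow> real"
  where "shift_norm s x = onorm (\<lambda>b. s *\<^sub>R b + x * b)"

definition top_of :: "'a \<Rightarrow> real"
  where "top_of x = (INF s\<in>{0..}. shift_norm s x - s)"

lemma bounded_linear_shift:
  fixes x :: 'a
  shows "bounded_linear (\<lambda>b. s *\<^sub>R b + x * b)"
  by (rule bounded_linear_add [OF bounded_linear_scaleR_right bounded_linear_mult_right])

lemma shift_norm_le: "norm (s *\<^sub>R b + x * b) \<le> shift_norm s x * norm b"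
  unfolding shift_norm_def by (rule onorm [OF bounded_linear_shift])

lemma shift_norm_leI:
  "(\<And>b. norm (s *\<^sub>R b + x * b) \<le> C * norm b) \<Longrightarrow> C \<ge> 0 \<Longrightarrow> shift_norm s x \<le> C"
  unfolding shift_norm_def by (rule onorm_bound)

lemma shift_norm_nonneg: "0 \<le> shift_norm s x"
  unfolding shift_norm_def by (rule onorm_pos_le [OF bounded_linear_shift])

lemma shift_norm_pn: "shift_norm s x = pn x [:s, 1:]"
proof -
  have "pact x [:s, 1:] = (\<lambda>b. s *\<^sub>R b + x * b)" by (simp add: fun_eq_iff)
  then show ?thesis by (simp add: shift_norm_def pn_def)
qed

lemma shift_norm_ge:
  assumes "s \<ge> 0"
  shows "- norm x \<le> shift_norm s x - s"
proof -
  obtain b :: 'a where b: "b \<noteq> 0" using nontrivial by blast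
  have "s * norm b \<le> norm (s *\<^sub>R b + x * b) + norm (x * b)"
    using norm_triangle_ineq4 [of "s *\<^sub>R b + x * b" "x * b"] assms by simp
  also have "\<dots> \<le> (shift_norm s x + norm x) * norm b"
    using shift_norm_le [of s b x] norm_mult_ineq [of x b] by (simp add: algebra_simps)
  finally show ?thesis using b by simp
qed

lemma top_of_le: "s \<ge> 0 \<Longrightarrow> top_of x \<le> shift_norm s x - s"
  unfolding top_of_def
  by (rule cINF_lower) (auto intro!: bdd_belowI [of _ "- norm x"] simp: shift_norm_ge)

lemma le_top_ofI: "(\<And>s. s \<ge> 0 \<Longrightarrow> c \<le> shift_norm s x - s) \<Longrightarrow> c \<le> top_of x"
  unfolding top_of_def by (rule cINF_greatest) auto

lemma top_of_le_norm: "top_of x \<le> norm x"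
proof -
  have "shift_norm 0 x \<le> norm x"
    by (rule shift_norm_leI) (simp_all add: norm_mult_ineq)
  then show ?thesis
    using top_of_le [of 0 x] by simp
qed

lemma shift_norm_add: "shift_norm (s + t) (x + y) \<le> shift_norm s x + shift_norm t y"
proof (rule shift_norm_leI)
  fix b
  have "(s + t) *\<^sub>R b + (x + y) * b = (s *\<^sub>R b + x * b) + (t *\<^sub>R b + y * b)"
    by (simp add: algebra_simps)
  then show "norm ((s + t) *\<^sub>R b + (x + y) * b) \<le> (shift_norm s x + shift_norm t y) * norm b"
    using norm_triangle_ineq [of "s *\<^sub>R b + x * b" "t *\<^sub>R b + y * b"]
      shift_norm_le [of s b x] shift_norm_le [of t b y] by (simp add: algebra_simps)
qed (simp add: shift_norm_nonneg)

lemma shift_norm_scaleR: "t > 0 \<Longrightarrow> shift_norm (t * s) (t *\<^sub>R x) = t * shift_norm s x"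
  using onorm_scaleR [OF bounded_linear_shift, of t s x]
  by (simp add: shift_norm_def scaleR_add_right)

lemma sublinear_top_of: "sublinear top_of"
  unfolding sublinear_def
proof (intro conjI allI impI)
  fix x y
  have "top_of (x + y) - (shift_norm s x - s) \<le> shift_norm t y - t" if "s \<ge> 0" "t \<ge> 0" for s t
    using top_of_le [of "s + t" "x + y"] shift_norm_add [of s t x y] that by simp
  then have "top_of (x + y) - (shift_norm s x - s) \<le> top_of y" if "s \<ge> 0" for s
    using that by (intro le_top_ofI) auto
  then have "top_of (x + y) - top_of y \<le> top_of x"
    by (intro le_top_ofI) (simp add: algebra_simps)
  then show "top_of (x + y) \<le> top_of x + top_of y" by simp
next
  fix t :: real and x assume t: "t > 0"
  have "top_of (t *\<^sub>R x) / t \<le> shift_norm s x - s" if "s \<ge> 0" for s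
    using top_of_le [of "t * s" "t *\<^sub>R x"] shift_norm_scaleR [OF t, of s x] that t
    by (simp add: field_simps)
  then have "top_of (t *\<^sub>R x) / t \<le> top_of x"
    by (rule le_top_ofI)
  then show "top_of (t *\<^sub>R x) \<le> t * top_of x"
    using t by (simp add: field_simps)
qed

lemma approx_eigenvalue_le_top_of:
  assumes "approx_eigenvalue (\<lambda>b. x * b) l"
  shows "l \<le> top_of x"
proof (rule le_top_ofI)
  fix s :: real assume s: "s \<ge> 0"
  show "l \<le> shift_norm s x - s"
  proof (rule field_le_epsilon)
    fix e :: real assume "e > 0"
    then obtain b where b: "b \<noteq> 0" "norm (x * b - l *\<^sub>R b) \<le> e * norm b"
      using approx_eigenvalueE [OF assms] by blast
    have "norm ((s + l) *\<^sub>R b) \<le> norm (s *\<^sub>R b + x * b) + norm (x * b - l *\<^sub>R b)"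
      using norm_triangle_ineq4 [of "s *\<^sub>R b + x * b" "x * b - l *\<^sub>R b"] by (simp add: algebra_simps)
    also have "\<dots> \<le> (shift_norm s x + e) * norm b"
      using shift_norm_le [of s b x] b(2) by (simp add: algebra_simps)
    finally have "\<bar>s + l\<bar> \<le> shift_norm s x + e"
      using b(1) by simp
    then show "l \<le> shift_norm s x - s + e" by simp
  qed
qed

text \<open>
  For a self-adjoint \<open>x\<close> in \<open>BC\<close>, \<open>top_of x\<close> is the largest approximate eigenvalue: after a shift by
  \<open>s > norm x\<close> the norm can be attained only at the upper end.
\<close>

lemma approx_eigenvalue_top_of:
  assumes "x \<in> SA"
  shows "approx_eigenvalue (\<lambda>b. x * b) (top_of x)"
proof -
  define s n where "s = norm x + 1" and "n = shift_norm s x"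
  have s: "s \<ge> 0" by (simp add: s_def)
  have n: "n > 0"
    using shift_norm_ge [OF s, of x] by (simp add: s_def n_def)
  have shift: "approx_eigenvalue (\<lambda>b. x * b) (l - s)" if "approx_eigenvalue (pact x [:s, 1:]) l" for l
    using that unfolding approx_eigenvalue_def by (simp add: algebra_simps)
  have "\<not> approx_eigenvalue (\<lambda>b. x * b) (- n - s)"
    using approx_eigenvalue_bound [of x "- n - s"] n by (auto simp: s_def)
  then have "approx_eigenvalue (\<lambda>b. x * b) (n - s)"
    using approx_eigenvalue_norm [OF assms, of "[:s, 1:]"] n shift
    by (auto simp: n_def shift_norm_pn)
  moreover from this have "n - s = top_of x"
    using approx_eigenvalue_le_top_of top_of_le [OF s, of x] by (intro antisym) (auto simp: n_def)
  ultimately show ?thesis by simp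
qed

lemma norm_top_of:
  assumes "x \<in> SA"
  shows "norm x = top_of x \<or> norm x = top_of (- x)"
proof (cases "x = 0")
  case True
  then show ?thesis by (simp add: sublinear_zero [OF sublinear_top_of])
next
  case False
  have p: "pact x [:0, 1:] = (\<lambda>b. x * b)" by (simp add: fun_eq_iff)
  have "pn x [:0, 1:] = norm x"
  proof (rule antisym)
    show "pn x [:0, 1:] \<le> norm x"
      by (rule pn_leI) (simp_all add: norm_mult_ineq)
    have "norm x * norm x \<le> pn x [:0, 1:] * norm x"
      using pact_le [of x "[:0, 1:]" x] Bstar_identity [of x] assms
      by (simp add: SA_def power2_eq_square)
    then show "norm x \<le> pn x [:0, 1:]" using False by simp
  qed
  then have "approx_eigenvalue (\<lambda>b. x * b) (norm x) \<or> approx_eigenvalue (\<lambda>b. x * b) (- norm x)"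
    using approx_eigenvalue_norm [OF assms, of "[:0, 1:]"] False p by simp
  then have "norm x \<le> top_of x \<or> norm x \<le> top_of (- x)"
    using approx_eigenvalue_le_top_of [of x] approx_eigenvalue_le_top_of [of "- x" "norm x"]
      approx_eigenvalue_times_uminus [of x "- norm x"] by auto
  then show ?thesis
    using top_of_le_norm [of x] top_of_le_norm [of "- x"] by auto
qed

lemma top_of_uminus_square:
  assumes "h \<in> SA"
  shows "top_of (- (h * h)) \<le> 0"
proof (rule ccontr)
  define l where "l = top_of (- (h * h))"
  assume "\<not> top_of (- (h * h)) \<le> 0"
  then have l: "l > 0" by (simp add: l_def)
  have "approx_eigenvalue (\<lambda>b. - (h * h) * b) l"
    unfolding l_def using assms by (intro approx_eigenvalue_top_of SA_minus SA_square)
  then obtain b where b: "b \<noteq> 0" "norm (- (h * h) * b - l *\<^sub>R b) \<le> l / 2 * norm b"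
    using approx_eigenvalueE [of _ l "l / 2"] l by auto
  have "- (h * h) * b - l *\<^sub>R b = - pact h ([:l:] + [:0, 1:] * [:0, 1:]) b"
    by (simp add: mult.assoc)
  then have "norm (- (h * h) * b - l *\<^sub>R b) = norm (pact h ([:l:] + [:0, 1:] * [:0, 1:]) b)"
    by (simp only: norm_minus_cancel)
  then have "l * norm b \<le> norm (- (h * h) * b - l *\<^sub>R b)"
    using norm_add_square_ge [OF assms, of l b "[:0, 1:]"] l by (simp only:)
  moreover have "l * norm b > 0" using b l by simp
  ultimately show False using b(2) by simp
qed

text \<open>
  With \<open>y = h + i k\<close>, the sum \<open>star y * y + y * star y\<close> is \<open>2 (h\<^sup>2 + k\<^sup>2)\<close>, so \<open>- y * star y\<close> lies
  below \<open>star y * y\<close>; and away from zero both products have the same approximate eigenvalues.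
\<close>

lemma top_of_uminus_star_times_le:
  assumes y: "y \<in> BC" and K: "top_of (star y * y) \<le> K" "K \<ge> 0"
  shows "top_of (- (star y * y)) \<le> K"
proof (cases "top_of (- (star y * y)) \<le> 0")
  case False
  define m where "m = top_of (- (star y * y))"
  have "approx_eigenvalue (\<lambda>b. - (star y * y) * b) m"
    unfolding m_def using y by (intro approx_eigenvalue_top_of SA_minus SA_star_times)
  then have "approx_eigenvalue (\<lambda>b. star y * y * b) (- m)"
    using approx_eigenvalue_times_uminus [of "- (star y * y)" m] by simp
  then have "approx_eigenvalue (\<lambda>b. y * star y * b) (- m)"
    using False by (intro approx_eigenvalue_swap) (auto simp: m_def)
  then have "approx_eigenvalue (\<lambda>b. - (y * star y) * b) m"
    using approx_eigenvalue_times_uminus [of "y * star y" "- m"] by simp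
  then have m: "m \<le> top_of (- (y * star y))"
    by (rule approx_eigenvalue_le_top_of)
  define a c where "a = y + star y" and "c = lmul quat_i (y - star y)"
  have a: "a \<in> SA"
    using y by (simp add: a_def SA_def BC_add BC_star star_add star_star add.commute)
  have d: "y - star y \<in> BC" using y by (simp add: BC_diff BC_star)
  have c: "c \<in> SA"
  proof -
    have "c \<in> BC"
      using lmul_rmul' [of quat_i "y - star y" quat_i] BC_D [OF d] by (simp add: c_def BC_def)
    moreover have "star c = c"
    proof -
      have "star (y - star y) = - (y - star y)"
        by (simp add: star_diff star_star)
      then show ?thesis
        by (simp only: c_def star_lmul qcnj_quat_i rmul_minus' rmul_minus BC_D [OF d] minus_minus)
    qed
    ultimately show ?thesis by (simp add: SA_def)
  qed
  have cc: "c * c = - ((y - star y) * (y - star y))"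
    by (simp add: c_def lmul_times BC_times_i [OF d] lmul_lmul' quat_i_squared lmul_minus')
  have "a * a + c * c = 2 *\<^sub>R (star y * y + y * star y)"
    unfolding cc by (simp add: a_def algebra_simps scaleR_2)
  then have "(1/2) *\<^sub>R (a * a + c * c) = star y * y + y * star y"
    by simp
  then have e: "y * star y = (1/2) *\<^sub>R (a * a) + (1/2) *\<^sub>R (c * c) - star y * y"
    by (simp add: scaleR_add_right)
  have "- (y * star y) = star y * y + (1/2) *\<^sub>R (- (a * a)) + (1/2) *\<^sub>R (- (c * c))"
    unfolding e by simp
  then have "top_of (- (y * star y)) \<le> top_of (star y * y) + top_of ((1/2) *\<^sub>R (- (a * a)))
      + top_of ((1/2) *\<^sub>R (- (c * c)))"
    using sublinear_add [OF sublinear_top_of] by (metis add_right_mono order_trans)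
  also have "\<dots> \<le> K"
    using top_of_uminus_square [OF a] top_of_uminus_square [OF c] K
    by (simp only: sublinear_scaleR [OF sublinear_top_of])
  finally show ?thesis
    using m by (simp add: m_def)
qed (use K in simp)

text \<open>
  The maximum of \<open>t (1 - t)\<^sup>2\<close> on \<open>[-1, 1]\<close> is \<open>4/27\<close>. If \<open>\<mu>\<close> is larger, the equation
  \<open>t (1 - t)\<^sup>2 = \<mu>\<close> has one real root \<open>r > 4/3\<close>, outside the range of approximate eigenvalues, and the
  complementary quadratic factor has no real root.
\<close>

lemma top_of_cubic_le:
  assumes q: "q \<in> SA" and n: "norm q \<le> 1"
  shows "top_of (q - 2 *\<^sub>R (q * q) + q * q * q) \<le> 1/4"
proof (rule ccontr)
  define F where "F = q - 2 *\<^sub>R (q * q) + q * q * q"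
  define \<mu> where "\<mu> = top_of F"
  assume "\<not> ?thesis"
  then have \<mu>: "\<mu> > 1/4" by (simp add: \<mu>_def F_def)
  have F: "F \<in> SA"
    using q unfolding F_def
    by (simp add: SA_def BC_add BC_diff BC_mult BC_scaleR star_add star_diff star_scaleR star_times mult.assoc)
  have nq: "norm (q * q) \<le> 1" "norm (q * q * q) \<le> 1"
  proof -
    have "norm q * norm q \<le> 1 * 1" using n by (intro mult_mono) auto
    then show 2: "norm (q * q) \<le> 1" using norm_mult_ineq [of q q] by simp
    have "norm (q * q) * norm q \<le> 1 * 1" using n 2 by (intro mult_mono) auto
    then show "norm (q * q * q) \<le> 1" using norm_mult_ineq [of "q * q" q] by simp
  qed
  have "norm F \<le> norm q + norm (2 *\<^sub>R (q * q)) + norm (q * q * q)"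
    unfolding F_def by (meson add_right_mono norm_triangle_ineq norm_triangle_ineq4 order_trans)
  then have "\<mu> \<le> 4"
    using top_of_le_norm [of F] n nq by (simp add: \<mu>_def)
  have "\<exists>r\<ge>4/3. r \<le> 3 \<and> r * (1 - r)\<^sup>2 = \<mu>"
  proof (rule IVT' )
    show "4/3 * (1 - 4/3)\<^sup>2 \<le> \<mu>" using \<mu> by (simp add: power2_eq_square)
    show "\<mu> \<le> 3 * (1 - 3)\<^sup>2" using \<open>\<mu> \<le> 4\<close> by simp
    show "continuous_on {4/3..3} (\<lambda>r::real. r * (1 - r)\<^sup>2)" by (intro continuous_intros)
  qed simp
  then obtain r where r: "4/3 \<le> r" "r * (1 - r)\<^sup>2 = \<mu>" by blast
  have "r \<noteq> 4/3"
  proof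
    assume eq: "r = 4/3"
    have "\<mu> = 4/27" using r(2) unfolding eq by (simp add: power2_eq_square)
    then show False using \<mu> by simp
  qed
  with r(1) have r1: "r > 4/3" by simp
  define \<beta> where "\<beta> = r * (3 * r - 4) / 4"
  have \<beta>: "\<beta> > 0" using r1 by (simp add: \<beta>_def)
  define w where "w = [:(r - 2) / 2, 1:]"
  have fact: "[:- \<mu>, 1, -2, 1:] = ([:\<beta>:] + w * w) * [:- r, 1:]"
    by (simp add: \<beta>_def w_def r(2) [symmetric] power2_eq_square field_simps)
  have low: "\<beta> / 3 * norm b \<le> norm (F * b - \<mu> *\<^sub>R b)" for b
  proof -
    have "F * b - \<mu> *\<^sub>R b = pact q [:- \<mu>, 1, -2, 1:] b"
      by (simp add: F_def algebra_simps)
    also have "\<dots> = pact q ([:\<beta>:] + w * w) (q * b - r *\<^sub>R b)"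
      unfolding fact pact_mult by simp
    finally have "\<beta> * norm (q * b - r *\<^sub>R b) \<le> norm (F * b - \<mu> *\<^sub>R b)"
      using norm_add_square_ge [OF q, of \<beta> "q * b - r *\<^sub>R b" w] \<beta> by simp
    moreover have "1/3 * norm b \<le> norm (q * b - r *\<^sub>R b)"
    proof -
      have "norm (q * b) \<le> 1 * norm b"
        using norm_mult_ineq [of q b] n by (meson mult_right_mono norm_ge_zero order_trans)
      moreover have "4/3 * norm b \<le> r * norm b" using r1 by (intro mult_right_mono) auto
      moreover have "r * norm b \<le> norm (q * b) + norm (q * b - r *\<^sub>R b)"
        using norm_triangle_ineq4 [of "q * b" "q * b - r *\<^sub>R b"] r1 by simp
      ultimately show ?thesis by simp
    qed
    then have "\<beta> * (1/3 * norm b) \<le> \<beta> * norm (q * b - r *\<^sub>R b)"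
      using \<beta> by (intro mult_left_mono) auto
    ultimately show ?thesis by simp
  qed
  obtain b where b: "b \<noteq> 0" "norm (F * b - \<mu> *\<^sub>R b) \<le> \<beta> / 6 * norm b"
    using approx_eigenvalueE [OF approx_eigenvalue_top_of [OF F], of "\<beta> / 6"] \<beta>
    by (auto simp: \<mu>_def)
  moreover have "\<beta> * norm b > 0"
    using b \<beta> by simp
  ultimately show False
    using low [of b] by simp
qed

text \<open>
  Replacing \<open>y\<close>, normalized so that \<open>q = star y * y\<close> has norm at most one, by \<open>z = y (1 - q)\<close> turns
  \<open>q\<close> into \<open>q (1 - q)\<^sup>2\<close>. That shrinks the upper bound to a quarter, but moves negative approximate
  eigenvalues further away from zero.
\<close>

lemma top_of_uminus_star_times_shrink:
  assumes "y \<in> BC" "K > 0" "top_of (star y * y) \<le> K"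
  shows "top_of (- (star y * y)) \<le> K / 4 ^ n"
  using assms
proof (induction n arbitrary: y K)
  case 0
  then show ?case
    using top_of_uminus_star_times_le by simp
next
  case (Suc n)
  define y1 where "y1 = (1 / sqrt K) *\<^sub>R y"
  define q where "q = star y1 * y1"
  have y1: "y1 \<in> BC" using Suc.prems by (simp add: y1_def BC_scaleR)
  have q: "q \<in> SA" using y1 by (simp add: q_def SA_star_times)
  have qK: "q = (1 / K) *\<^sub>R (star y * y)"
    using Suc.prems(2) by (simp add: q_def y1_def star_scaleR)
  have scale: "top_of (t *\<^sub>R x) = t * top_of x" if "t > 0" for t x
    using sublinear_scaleR [OF sublinear_top_of that] .
  have "top_of q \<le> 1"
    using Suc.prems(2,3) by (simp add: qK scale)
  moreover from this have "top_of (- q) \<le> 1"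
    using top_of_uminus_star_times_le [OF y1, of 1] by (simp add: q_def)
  ultimately have nq: "norm q \<le> 1"
    using norm_top_of [OF q] by auto
  define z where "z = y1 - y1 * q"
  have z: "z \<in> BC"
    using y1 SA_BC [OF q] by (simp add: z_def BC_diff BC_mult)
  have zz: "star z * z = q - 2 *\<^sub>R (q * q) + q * q * q"
  proof -
    have "star z * z = (star y1 - q * star y1) * (y1 - y1 * q)"
      using SA_star [OF q] by (simp add: z_def star_diff star_times)
    also have "\<dots> = star y1 * y1 - star y1 * y1 * q - q * (star y1 * y1) + q * (star y1 * y1) * q"
      by (simp add: algebra_simps)
    finally show ?thesis
      by (simp add: q_def [symmetric] scaleR_2)
  qed
  have IH: "top_of (- (star z * z)) \<le> (1/4) / 4 ^ n"
    using top_of_cubic_le [OF q nq] by (intro Suc.IH z) (simp_all add: zz)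
  have "top_of (- q) \<le> 1 / 4 ^ Suc n"
  proof (cases "top_of (- q) \<le> 0")
    case False
    define d where "d = top_of (- q)"
    have d: "d > 0" using False by (simp add: d_def)
    have "approx_eigenvalue (\<lambda>b. - q * b) d"
      unfolding d_def by (intro approx_eigenvalue_top_of SA_minus q)
    then have "approx_eigenvalue (\<lambda>b. q * b) (- d)"
      using approx_eigenvalue_times_uminus [of "- q" d] by simp
    then have "approx_eigenvalue (pact q [:0, 1, -2, 1:]) (poly [:0, 1, -2, 1:] (- d))"
      by (rule approx_eigenvalue_poly)
    moreover have "pact q [:0, 1, -2, 1:] = (\<lambda>b. star z * z * b)"
      unfolding zz by (simp add: fun_eq_iff algebra_simps)
    moreover have "poly [:0, 1, -2, 1:] (- d) = - (d * (1 + d)\<^sup>2)"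
      by (simp add: power2_eq_square algebra_simps)
    ultimately have "approx_eigenvalue (\<lambda>b. star z * z * b) (- (d * (1 + d)\<^sup>2))"
      by (simp only:)
    then have "approx_eigenvalue (\<lambda>b. - (star z * z) * b) (d * (1 + d)\<^sup>2)"
      using approx_eigenvalue_times_uminus [of "star z * z" "- (d * (1 + d)\<^sup>2)"] by simp
    then have "d * (1 + d)\<^sup>2 \<le> top_of (- (star z * z))"
      by (rule approx_eigenvalue_le_top_of)
    moreover have "d * 1 \<le> d * (1 + d)\<^sup>2"
      using d by (intro mult_left_mono) (auto simp: power2_eq_square algebra_simps)
    ultimately show ?thesis
      using IH by (simp add: d_def)
  qed (auto intro: order_trans)
  moreover have "top_of (- q) = 1 / K * top_of (- (star y * y))"
    using scale [of "1 / K" "- (star y * y)"] Suc.prems(2) by (simp add: qK)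
  ultimately show ?case
    using Suc.prems(2) by (simp add: field_simps)
qed

text \<open>This is \<open>star y * y \<ge> 0\<close>: the shrinking step can be repeated indefinitely.\<close>

theorem top_of_uminus_star_times:
  assumes "y \<in> BC"
  shows "top_of (- (star y * y)) \<le> 0"
proof -
  define K where "K = norm (star y * y) + 1"
  have "top_of (star y * y) \<le> K" "K > 0"
    using top_of_le_norm [of "star y * y"] by (auto simp: K_def add_nonneg_pos)
  then have "top_of (- (star y * y)) \<le> K / 4 ^ n" for n
    using top_of_uminus_star_times_shrink [OF assms] by blast
  moreover have "(\<lambda>n. K / 4 ^ n) \<longlonglongrightarrow> 0"
    by (rule LIMSEQ_divide_realpow_zero) simp
  ultimately show ?thesis
    by (intro LIMSEQ_le_const) auto
qed

end

section \<open>Positive functionals\<close>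

context H_Bstar_algebra
begin

text \<open>The projection onto the commutant of \<open>i\<close> along the elements that anticommute with \<open>i\<close>.\<close>

definition proj_BC :: "'a \<Rightarrow> 'a"
  where "proj_BC z = (1/2) *\<^sub>R (z - lmul quat_i (rmul z quat_i))"

definition anti_BC :: "'a set" where "anti_BC = {z. lmul quat_i z = - rmul z quat_i}"

lemma lmul_i_lmul_i: "lmul quat_i (lmul quat_i z) = - z"
  and rmul_i_rmul_i: "rmul (rmul z quat_i) quat_i = - z"
  by (simp_all add: lmul_lmul' rmul_rmul' quat_i_squared lmul_minus' rmul_minus')

lemma proj_BC_mem: "proj_BC z \<in> BC"
  by (simp add: BC_def proj_BC_def lmul_scaleR rmul_scaleR lmul_diff rmul_diff lmul_i_lmul_i
      lmul_rmul' rmul_i_rmul_i lmul_minus)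

lemma proj_BC_anti: "z - proj_BC z \<in> anti_BC"
proof -
  have e: "z - proj_BC z = (1/2) *\<^sub>R (z + lmul quat_i (rmul z quat_i))"
  proof -
    have "z = (1/2) *\<^sub>R z + (1/2) *\<^sub>R z" by (simp flip: scaleR_add_left)
    then show ?thesis by (simp add: proj_BC_def algebra_simps)
  qed
  show ?thesis
    unfolding anti_BC_def mem_Collect_eq e
    by (simp add: lmul_scaleR rmul_scaleR lmul_add rmul_add lmul_i_lmul_i
        lmul_rmul' rmul_i_rmul_i lmul_minus algebra_simps)
qed

lemma linear_proj_BC: "linear proj_BC"
  by (intro linearI)
    (simp_all add: proj_BC_def lmul_add rmul_add lmul_scaleR rmul_scaleR algebra_simps)

lemma norm_proj_BC_le: "norm (proj_BC z) \<le> norm z"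
proof -
  have "norm (lmul quat_i (rmul z quat_i)) \<le> norm z"
    using norm_lmul_le [of quat_i "rmul z quat_i"] norm_rmul_le [of z quat_i] by simp
  then show ?thesis
    using norm_triangle_ineq4 [of z "lmul quat_i (rmul z quat_i)"] by (simp add: proj_BC_def)
qed

lemma proj_BC_of_BC: "z \<in> BC \<Longrightarrow> proj_BC z = z"
  by (simp add: proj_BC_def BC_D lmul_i_lmul_i flip: scaleR_2)

lemma proj_BC_of_anti: "z \<in> anti_BC \<Longrightarrow> proj_BC z = 0"
proof -
  assume "z \<in> anti_BC"
  then have "rmul z quat_i = - lmul quat_i z" by (simp add: anti_BC_def)
  then show ?thesis by (simp add: proj_BC_def lmul_minus lmul_i_lmul_i)
qed

lemma anti_BC_star: "z \<in> anti_BC \<Longrightarrow> star z \<in> anti_BC"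
proof -
  assume "z \<in> anti_BC"
  then have "star (lmul quat_i z) = star (- rmul z quat_i)" by (simp add: anti_BC_def)
  then show "star z \<in> anti_BC"
    by (simp add: anti_BC_def star_minus star_lmul star_rmul qcnj_quat_i lmul_minus' rmul_minus')
qed

lemma BC_times_anti: "b \<in> BC \<Longrightarrow> c \<in> anti_BC \<Longrightarrow> b * c \<in> anti_BC"
  and anti_times_BC: "c \<in> anti_BC \<Longrightarrow> b \<in> BC \<Longrightarrow> c * b \<in> anti_BC"
proof -
  assume b: "b \<in> BC" and c: "c \<in> anti_BC"
  have "lmul quat_i (b * c) = b * lmul quat_i c"
    using b by (simp add: BC_times_i)
  then show "b * c \<in> anti_BC"
    using c by (simp add: anti_BC_def times_rmul)
  have "lmul quat_i (c * b) = - (rmul c quat_i * b)"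
    using c by (simp add: anti_BC_def flip: lmul_times)
  then show "c * b \<in> anti_BC"
    using b by (simp add: anti_BC_def rmul_times times_rmul BC_def)
qed

text \<open>
  Multiplication by \<open>j\<close> carries the anticommuting part into the commutant of \<open>i\<close>, and does not
  change \<open>star c * c\<close>.
\<close>

lemma proj_BC_star_times:
  defines "b \<equiv> \<lambda>x. proj_BC x" and "y \<equiv> \<lambda>x. lmul quat_j (x - proj_BC x)"
  shows "proj_BC (star x * x) = star (b x) * b x + star (y x) * y x"
    and "b x \<in> BC" "y x \<in> BC" "norm x \<le> norm (b x) + norm (y x)"
proof -
  define c where "c = x - b x"
  have b: "b x \<in> BC" and c: "c \<in> anti_BC"
    by (simp_all add: b_def c_def proj_BC_mem proj_BC_anti)
  have yc: "y x = lmul quat_j c" by (simp add: y_def c_def b_def)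
  have "lmul quat_i (lmul quat_j c) = - lmul quat_j (lmul quat_i c)"
    by (simp add: lmul_lmul' quat_ji lmul_minus')
  also have "\<dots> = rmul (lmul quat_j c) quat_i"
    using c by (simp add: anti_BC_def lmul_rmul' lmul_minus)
  finally show y: "y x \<in> BC" by (simp add: yc BC_def)
  have "star (y x) * y x = star c * c"
    by (simp add: yc star_lmul rmul_times lmul_lmul' qcnj_quat_j quat_j_squared)
  then have sc: "star c * c = star (y x) * y x" ..
  have "star x * x = star (b x) * b x + star (b x) * c + star c * b x + star (y x) * y x"
  proof -
    have "x = b x + c" by (simp add: c_def)
    then have "star x * x = (star (b x) + star c) * (b x + c)"
      by (metis star_add)
    then show ?thesis by (simp add: algebra_simps sc)
  qed
  moreover have "proj_BC (star (b x) * b x) = star (b x) * b x"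
    "proj_BC (star (y x) * y x) = star (y x) * y x"
    "proj_BC (star (b x) * c) = 0" "proj_BC (star c * b x) = 0"
    using b y c
    by (simp_all add: proj_BC_of_BC proj_BC_of_anti BC_mult BC_star BC_times_anti anti_times_BC
        anti_BC_star)
  ultimately show "proj_BC (star x * x) = star (b x) * b x + star (y x) * y x"
    by (simp add: linear_add [OF linear_proj_BC])
  have "c = lmul (- quat_j) (y x)"
    by (simp add: yc lmul_lmul' quat_j_squared)
  then have "norm c \<le> norm (y x)"
    using norm_lmul_le [of "- quat_j" "y x"] by simp
  then show "norm x \<le> norm (b x) + norm (y x)"
    using norm_triangle_ineq [of "b x" c] by (simp add: c_def)
qed (simp add: b_def proj_BC_mem)

end

text \<open>
  Domination by \<open>top_of\<close> gives positivity and the norm bound at once. At \<open>star v * v\<close> the functional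
  attains the norm, because the norm of a self-adjoint element is the top of itself or of its negative.
\<close>

lemma (in nontrivial_H_Bstar_algebra) positive_functional_on_BC:
  assumes v: "v \<in> BC"
  obtains f where "linear f" "\<And>z. \<bar>f z\<bar> \<le> norm z" "\<And>y. y \<in> BC \<Longrightarrow> 0 \<le> f (star y * y)"
    "(norm v)\<^sup>2 \<le> f (star v * v)"
proof -
  obtain f where f: "linear f" "\<And>z. f z \<le> top_of z" "f (star v * v) = top_of (star v * v)"
    using Hahn_Banach_at_point [OF sublinear_top_of] by blast
  show thesis
  proof (rule that [OF f(1)])
    show "\<bar>f z\<bar> \<le> norm z" for z
      using f(2) [of z] f(2) [of "- z"] top_of_le_norm [of z] top_of_le_norm [of "- z"]
      by (simp add: linear_neg [OF f(1)])
    show "0 \<le> f (star y * y)" if "y \<in> BC" for y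
      using f(2) [of "- (star y * y)"] top_of_uminus_star_times [OF that]
      by (simp add: linear_neg [OF f(1)])
    show "(norm v)\<^sup>2 \<le> f (star v * v)"
      using norm_top_of [OF SA_star_times [OF v]] top_of_uminus_star_times [OF v]
        sublinear_minus [OF sublinear_top_of, of "star v * v"]
      by (auto simp: f(3) Bstar_identity)
  qed
qed

text \<open>
  The functional on \<open>BC\<close> is composed with the projection and with the self-adjoint part. It is built
  for the larger of the two components of \<open>x\<close>, which has at least half the norm of \<open>x\<close>; this is the
  source of the factor \<open>1/4\<close>.
\<close>

lemma (in H_Bstar_algebra) positive_functional_exists:
  assumes "x \<noteq> 0"
  obtains f where "linear f" "\<And>z. \<bar>f z\<bar> \<le> norm z" "\<And>z. f (star z) = f z"
    "\<And>z. 0 \<le> f (star z * z)" "(norm x)\<^sup>2 / 4 \<le> f (star x * x)"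
proof -
  interpret nontrivial_H_Bstar_algebra lmul rmul star
    using assms by unfold_locales blast
  note pr = proj_BC_star_times
  obtain v where v: "v \<in> BC" "norm x \<le> 2 * norm v"
    and vx: "v = proj_BC x \<or> v = lmul quat_j (x - proj_BC x)"
  proof (cases "norm x \<le> 2 * norm (proj_BC x)")
    case True
    then show thesis using that [of "proj_BC x"] pr(2) [of x] by simp
  next
    case False
    then show thesis
      using that [of "lmul quat_j (x - proj_BC x)"] pr(3,4) [of x] by simp
  qed
  obtain f0 where f0: "linear f0" "\<And>z. \<bar>f0 z\<bar> \<le> norm z" "\<And>y. y \<in> BC \<Longrightarrow> 0 \<le> f0 (star y * y)"
    "(norm v)\<^sup>2 \<le> f0 (star v * v)"
    using positive_functional_on_BC [OF v(1)] by blast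
  define f where "f z = f0 (proj_BC ((1/2) *\<^sub>R (z + star z)))" for z
  have f_star_times: "f (star z * z) = f0 (star (proj_BC z) * proj_BC z)
      + f0 (star (lmul quat_j (z - proj_BC z)) * lmul quat_j (z - proj_BC z))" for z
    by (simp add: f_def star_times star_star pr(1) linear_add [OF f0(1)] flip: scaleR_2)
  show thesis
  proof (rule that)
    show "linear f"
      by (intro linearI)
        (simp_all add: f_def star_add star_scaleR linear_add [OF linear_proj_BC] linear_add [OF f0(1)]
          linear_cmul [OF linear_proj_BC] linear_cmul [OF f0(1)] algebra_simps)
    show "\<bar>f z\<bar> \<le> norm z" for z
    proof -
      have "\<bar>f z\<bar> \<le> norm ((1/2) *\<^sub>R (z + star z))"
        unfolding f_def using f0(2) norm_proj_BC_le by (rule order_trans)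
      also have "\<dots> \<le> norm z"
        using norm_triangle_ineq [of z "star z"] by simp
      finally show ?thesis .
    qed
    show "f (star z) = f z" for z
      by (simp add: f_def star_star add.commute)
    show "0 \<le> f (star z * z)" for z
      unfolding f_star_times using f0(3) pr(2,3) by (intro add_nonneg_nonneg) auto
    have "(norm x)\<^sup>2 / 4 \<le> (norm v)\<^sup>2"
      using power_mono [OF v(2), of 2] by (simp add: power_mult_distrib)
    also have "\<dots> \<le> f (star x * x)"
      using vx f0(4) f0(3) [OF pr(2) [of x]] f0(3) [OF pr(3) [of x]] by (auto simp: f_star_times)
    finally show "(norm x)\<^sup>2 / 4 \<le> f (star x * x)" .
  qed
qed

section \<open>The representation\<close>

text \<open>
  A family of positive functionals indexed by the algebra itself: \<open>\<Phi> a\<close> is responsible for the norm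
  of \<open>a\<close>, or rather of \<open>a * star a\<close>.
\<close>

locale GNS = H_Bstar_algebra lmul rmul star
  for lmul :: "quat \<Rightarrow> 'a::{real_normed_algebra, banach} \<Rightarrow> 'a"
    and rmul :: "'a \<Rightarrow> quat \<Rightarrow> 'a"
    and star :: "'a \<Rightarrow> 'a" +
  fixes \<Phi> :: "'a \<Rightarrow> 'a \<Rightarrow> real"
  assumes linear_\<Phi>: "linear (\<Phi> a)"
    and \<Phi>_le: "\<bar>\<Phi> a z\<bar> \<le> norm z"
    and \<Phi>_star: "\<Phi> a (star z) = \<Phi> a z"
    and \<Phi>_nonneg: "0 \<le> \<Phi> a (star z * z)"
    and \<Phi>_large: "(norm (a * star a))\<^sup>2 / 4 \<le> \<Phi> a (a * star a * (a * star a))"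
begin

lemmas \<Phi>_simps = linear_add [OF linear_\<Phi>] linear_diff [OF linear_\<Phi>] linear_cmul [OF linear_\<Phi>]
  linear_0 [OF linear_\<Phi>]

lemma \<Phi>_cauchy_schwarz: "(\<Phi> a (star z * w))\<^sup>2 \<le> \<Phi> a (star z * z) * \<Phi> a (star w * w)"
proof (rule quadratic_discriminant_bound)
  fix t
  have "0 \<le> \<Phi> a (star (z - t *\<^sub>R w) * (z - t *\<^sub>R w))" by (rule \<Phi>_nonneg)
  moreover have "\<Phi> a (star w * z) = \<Phi> a (star z * w)"
    using \<Phi>_star [of a "star w * z"] by (simp add: star_times star_star)
  ultimately show "2 * t * \<Phi> a (star z * w) - t\<^sup>2 * \<Phi> a (star w * w) \<le> \<Phi> a (star z * z)"
    by (simp add: star_diff star_scaleR \<Phi>_simps power2_eq_square algebra_simps)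
qed (rule \<Phi>_nonneg)

text \<open>
  Iterating the Cauchy-Schwarz inequality along \<open>h, h\<^sup>2, h\<^sup>4, \<dots>\<close> turns the crude bound
  \<open>\<bar>\<Phi> a (star z * h * z)\<bar> \<le> (norm z)\<^sup>2 * norm h\<close> into one with the constant \<open>\<Phi> a (star z * z)\<close>.
\<close>

lemma \<Phi>_iterate:
  assumes "star h = h" "0 \<le> \<beta>" "\<Phi> a (star z * z) > 0"
    "\<Phi> a (star z * z) * \<beta> \<le> \<Phi> a (star z * (h * z))"
  shows "\<Phi> a (star z * z) * \<beta> ^ 2 ^ n \<le> (norm z)\<^sup>2 * norm h ^ 2 ^ n"
  using assms
proof (induction n arbitrary: h \<beta>)
  case 0
  have "\<Phi> a (star z * (h * z)) \<le> norm (star z * (h * z))"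
    using \<Phi>_le [of a "star z * (h * z)"] by simp
  also have "\<dots> \<le> norm z * (norm h * norm z)"
    using norm_mult_ineq [of "star z" "h * z"] norm_mult_ineq [of h z]
    by (simp add: order_trans [OF _ mult_left_mono])
  finally show ?case using 0 by (simp add: power2_eq_square mult_ac)
next
  case (Suc n)
  let ?t = "\<Phi> a (star z * z)"
  have "(?t * \<beta>)\<^sup>2 \<le> (\<Phi> a (star z * (h * z)))\<^sup>2"
    using Suc.prems by (intro power_mono) auto
  also have "\<dots> \<le> ?t * \<Phi> a (star (h * z) * (h * z))"
    by (rule \<Phi>_cauchy_schwarz)
  also have "star (h * z) * (h * z) = star z * (h * h * z)"
    using Suc.prems(1) by (simp add: star_times mult.assoc)
  finally have "?t * \<beta>\<^sup>2 \<le> \<Phi> a (star z * (h * h * z))"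
    using Suc.prems(3) by (simp add: power2_eq_square mult_ac)
  then have "?t * (\<beta>\<^sup>2) ^ 2 ^ n \<le> (norm z)\<^sup>2 * norm (h * h) ^ 2 ^ n"
    using Suc.prems by (intro Suc.IH) (auto simp: star_times)
  also have "\<dots> \<le> (norm z)\<^sup>2 * (norm h * norm h) ^ 2 ^ n"
    by (intro mult_left_mono power_mono norm_mult_ineq) auto
  finally show ?case
    by (simp add: power_mult power_mult_distrib flip: power2_eq_square power_mult)
qed

lemma \<Phi>_star_times_le:
  "\<Phi> a (star (c * z) * (c * z)) \<le> (norm c)\<^sup>2 * \<Phi> a (star z * z)"
proof -
  define h where "h = star c * c"
  define t where "t = \<Phi> a (star z * z)"
  have h: "star h = h" "norm h = (norm c)\<^sup>2"
    by (simp_all add: h_def star_times star_star Bstar_identity)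
  have eq: "star (c * z) * (c * z) = star z * (h * z)"
    by (simp add: h_def star_times mult.assoc)
  have t: "t \<ge> 0" by (simp add: t_def \<Phi>_nonneg)
  have "\<Phi> a (star z * (h * z)) \<le> norm h * t"
  proof (rule ccontr)
    assume *: "\<not> ?thesis"
    have "t > 0"
    proof (rule ccontr)
      assume "\<not> t > 0"
      then have "(\<Phi> a (star z * (h * z)))\<^sup>2 \<le> 0"
        using \<Phi>_cauchy_schwarz [of a z "h * z"] t by (simp add: t_def)
      then show False using * t \<open>\<not> t > 0\<close> by simp
    qed
    define \<beta> where "\<beta> = \<Phi> a (star z * (h * z)) / t"
    have \<beta>: "norm h < \<beta>" using * \<open>t > 0\<close> by (simp add: \<beta>_def field_simps)
    then have "0 < \<beta>" by (rule le_less_trans [OF norm_ge_zero])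
    have it: "t * \<beta> ^ 2 ^ n \<le> (norm z)\<^sup>2 * norm h ^ 2 ^ n" for n
      unfolding t_def using \<open>t > 0\<close> \<open>0 < \<beta>\<close>
      by (intro \<Phi>_iterate h) (auto simp: t_def [symmetric] \<beta>_def)
    have "norm h > 0"
      using it [of 0] \<open>t > 0\<close> \<open>0 < \<beta>\<close> by (cases "h = 0") (auto simp: mult_le_0_iff)
    define r where "r = \<beta> / norm h"
    have r: "r > 1" using \<beta> \<open>norm h > 0\<close> by (simp add: r_def)
    obtain n where n: "(norm z)\<^sup>2 / t < r ^ n"
      using real_arch_pow [OF r] by blast
    also have "\<dots> \<le> r ^ 2 ^ n"
      using r by (intro power_increasing) (auto simp: less_imp_le)
    finally have "(norm z)\<^sup>2 < t * r ^ 2 ^ n"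
      using \<open>t > 0\<close> by (simp add: field_simps)
    also have "t * r ^ 2 ^ n \<le> (norm z)\<^sup>2"
      using it [of n] \<open>norm h > 0\<close> by (simp add: r_def power_divide field_simps)
    finally show False by simp
  qed
  then show ?thesis by (simp add: eq h t_def)
qed

text \<open>
  One kernel for the orthogonal sum over all \<open>a\<close> of the Gelfand-Naimark-Segal spaces of the \<open>\<Phi> a\<close>.
\<close>

definition gk :: "'a \<times> 'a \<Rightarrow> 'a \<times> 'a \<Rightarrow> real"
  where "gk x y = (if fst x = fst y then \<Phi> (fst x) (star (snd x) * snd y) else 0)"

text \<open>
  Up to null vectors, a combination of points is determined by its parts, one algebra element for each
  first index.
\<close>

definition part :: "'a \<Rightarrow> (real \<times> 'a \<times> 'a) list \<Rightarrow> 'a"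
  where "part a v = (\<Sum>(c, i, b)\<leftarrow>v. if i = a then c *\<^sub>R b else 0)"

lemma part_Nil [simp]: "part a [] = 0"
  and part_Cons [simp]: "part a ((c, i, b) # v) = (if i = a then c *\<^sub>R b else 0) + part a v"
  by (simp_all add: part_def)

lemma ev_gk: "ev (gk (a, b)) v = \<Phi> a (star b * part a v)"
proof (induction v)
  case (Cons x v)
  then show ?case
    by (cases x) (auto simp: gk_def \<Phi>_simps algebra_simps)
qed (simp add: \<Phi>_simps)

lemma ev_ev_gk:
  assumes "finite S" "(fst \<circ> snd) ` set w \<subseteq> S"
  shows "ev (\<lambda>x. ev (gk x) v) w = (\<Sum>a\<in>S. \<Phi> a (star (part a w) * part a v))"
  using assms(2)
proof (induction w)
  case Nil
  then show ?case by (simp add: \<Phi>_simps)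
next
  case (Cons x w)
  obtain c i b where x: "x = (c, i, b)" by (cases x)
  have "\<Phi> a (star (part a (x # w)) * part a v) =
      (if i = a then c * \<Phi> a (star b * part a v) else 0) + \<Phi> a (star (part a w) * part a v)" for a
    by (simp add: x star_add star_scaleR \<Phi>_simps algebra_simps)
  then have "(\<Sum>a\<in>S. \<Phi> a (star (part a (x # w)) * part a v)) =
      c * \<Phi> i (star b * part i v) + (\<Sum>a\<in>S. \<Phi> a (star (part a w) * part a v))"
    using Cons.prems assms(1) by (simp add: sum.distrib x)
  then show ?case
    using Cons by (simp add: x ev_gk)
qed

sublocale pair_kernel gk
proof unfold_locales
  show "gk x y = gk y x" for x y
    using \<Phi>_star [of "fst x" "star (snd x) * snd y"] by (simp add: gk_def star_times star_star)
  show "0 \<le> ev (\<lambda>x. ev (gk x) v) v" for v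
    by (subst ev_ev_gk [of "(fst \<circ> snd) ` set v"]) (auto intro!: sum_nonneg \<Phi>_nonneg)
qed

lemma B_gk:
  assumes "finite S" "(fst \<circ> snd) ` set v \<subseteq> S"
  shows "B v v = (\<Sum>a\<in>S. \<Phi> a (star (part a v) * part a v))"
  using ev_ev_gk [OF assms, of v] by (simp add: B_def kf_def [abs_def])

lemma part_map:
  assumes "linear \<tau>"
  shows "part a (map (map_prod id (map_prod id \<tau>)) v) = \<tau> (part a v)"
proof (induction v)
  case (Cons x v)
  then show ?case
    by (cases x) (auto simp: linear_add [OF assms] linear_cmul [OF assms] linear_0 [OF assms])
qed (simp add: linear_0 [OF assms])

lemma dominatedI:
  assumes "linear \<tau>" "M \<ge> 0"
    and le: "\<And>a z. \<Phi> a (star (\<tau> z) * \<tau> z) \<le> M\<^sup>2 * \<Phi> a (star z * z)"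
  shows "dominated (map_prod id \<tau>) M"
  unfolding dominated_def
proof (intro conjI allI assms(2))
  fix v :: "(real \<times> 'a \<times> 'a) list"
  let ?S = "(fst \<circ> snd) ` set v" and ?w = "map (map_prod id (map_prod id \<tau>)) v"
  have "B ?w ?w = (\<Sum>a\<in>?S. \<Phi> a (star (part a ?w) * part a ?w))"
    by (rule B_gk) force+
  also have "\<dots> \<le> (\<Sum>a\<in>?S. M\<^sup>2 * \<Phi> a (star (part a v) * part a v))"
    unfolding part_map [OF assms(1)] by (intro sum_mono le)
  also have "\<dots> = M\<^sup>2 * B v v"
    by (subst B_gk [of ?S]) (auto simp: sum_distrib_left)
  finally show "B ?w ?w \<le> M\<^sup>2 * B v v" .
qed

lemma linear_times: "linear (\<lambda>b::'a. c * b)"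
  by (intro linearI) (simp_all add: algebra_simps)

lemma linear_lmul: "linear (lmul \<alpha>)"
  by (intro linearI) (simp_all add: lmul_add lmul_scaleR)

lemma dominated_times: "dominated (map_prod id (\<lambda>b. c * b)) (norm c)"
  by (intro dominatedI linear_times \<Phi>_star_times_le) simp

lemma qcnj_times_self: "qcnj \<alpha> * \<alpha> = of_real ((norm \<alpha>)\<^sup>2)"
  by (simp add: of_real_quat quat_arith norm_quat_def inner_quat_def)

lemma dominated_lmul: "dominated (map_prod id (lmul \<alpha>)) (norm \<alpha>)"
proof (intro dominatedI linear_lmul)
  fix a z
  have "star (lmul \<alpha> z) * lmul \<alpha> z = (norm \<alpha>)\<^sup>2 *\<^sub>R (star z * z)"
    by (simp only: star_lmul rmul_times lmul_lmul' qcnj_times_self lmul_of_real mult_scaleR_right)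
  then show "\<Phi> a (star (lmul \<alpha> z) * lmul \<alpha> z) \<le> (norm \<alpha>)\<^sup>2 * \<Phi> a (star z * z)"
    by (simp add: \<Phi>_simps)
qed simp

text \<open>
  Every function in the Hilbert space is linear in the second argument, because the corresponding
  combinations of points are null vectors of the kernel.
\<close>

lemma D_linear:
  assumes "F \<in> D"
  shows "F (a, r *\<^sub>R b + b') = r * F (a, b) + F (a, b')"
proof -
  let ?v = "[(1, a, r *\<^sub>R b + b'), (- r, a, b), (- 1, a, b')]"
  have "part i ?v = 0" for i by simp
  then have "B ?v ?v = 0"
    by (subst B_gk [of "{a}"]) (auto simp: \<Phi>_simps)
  then show ?thesis
    using ev_square_le [OF assms, of ?v] by simp
qed

lemma HQ_linear:
  assumes "g \<in> HQ"
  shows "g a (r *\<^sub>R b + b') = r *\<^sub>R g a b + g a b'"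
  using HQ_D [OF assms, THEN D_linear, of a r b b']
  by (simp add: cp_def quat_eq_iff plus_quat_def scaleR_quat_def)

lemma HQ_zero: "g \<in> HQ \<Longrightarrow> g a 0 = 0"
  using HQ_linear [of g a "1" 0 0] by simp

lemma HQ_add: "g \<in> HQ \<Longrightarrow> g a (b + b') = g a b + g a b'"
  using HQ_linear [of g a "1" b b'] by simp

lemma HQ_scaleR: "g \<in> HQ \<Longrightarrow> g a (r *\<^sub>R b) = r *\<^sub>R g a b"
  using HQ_linear [of g a r b 0] by (simp add: HQ_zero)

definition lH :: "quat \<Rightarrow> ('a \<Rightarrow> 'a \<Rightarrow> quat) \<Rightarrow> 'a \<Rightarrow> 'a \<Rightarrow> quat"
  where "lH \<alpha> = shift (lmul (qcnj \<alpha>))"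

definition \<pi> :: "'a \<Rightarrow> ('a \<Rightarrow> 'a \<Rightarrow> quat) \<Rightarrow> 'a \<Rightarrow> 'a \<Rightarrow> quat"
  where "\<pi> c = shift (\<lambda>b. star c * b)"

lemma lH_closed: "g \<in> HQ \<Longrightarrow> lH \<alpha> g \<in> HQ"
  unfolding lH_def by (rule shift_closed [OF dominated_lmul])

lemma \<pi>_closed: "g \<in> HQ \<Longrightarrow> \<pi> c g \<in> HQ"
  unfolding \<pi>_def by (rule shift_closed [OF dominated_times])

lemma ip_norm_\<pi>: "g \<in> HQ \<Longrightarrow> ip_norm qip (\<pi> c g) \<le> norm c * ip_norm qip g"
  using ip_norm_shift [OF dominated_times [of "star c"]] by (simp add: \<pi>_def)

lemma qip_\<pi>:
  assumes "g \<in> HQ" "h \<in> HQ"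
  shows "qip (\<pi> c g) h = qip g (\<pi> (star c) h)"
  unfolding \<pi>_def
  by (rule qip_shift_adjoint [OF dominated_times dominated_times _ assms])
    (auto simp: gk_def star_times star_star mult.assoc)

lemma qip_lH:
  assumes "g \<in> HQ" "h \<in> HQ"
  shows "qip (lH \<alpha> g) h = qip g (lH (qcnj \<alpha>) h)"
  unfolding lH_def
  by (rule qip_shift_adjoint [OF dominated_lmul dominated_lmul _ assms])
    (auto simp: gk_def star_lmul rmul_times)

lemma Hilbert_H_bimodule_HQ: "Hilbert_H_bimodule HQ lH rmH qip"
proof (intro Hilbert_H_bimodule.intro Hilbert_H_bimodule_axioms.intro H_inner_product_HQ
    H_vector_space.intro H_vector_space_axioms.intro right_H_module_HQ)
  fix x y :: "'a \<Rightarrow> 'a \<Rightarrow> quat" and \<alpha> \<beta> r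
  assume x: "x \<in> HQ"
  show "lH \<alpha> x \<in> HQ" by (rule lH_closed [OF x])
  show "lH 1 x = x" by (simp add: lH_def shift_def)
  show "lH \<alpha> (lH \<beta> x) = lH (\<alpha> * \<beta>) x"
    by (simp add: lH_def shift_def lmul_lmul' qcnj_mult)
  show "lH (\<alpha> + \<beta>) x = lH \<alpha> x + lH \<beta> x"
    by (simp add: lH_def shift_def qcnj_add lmul_add' HQ_add [OF x] fun_eq_iff)
  show "rmH (lH \<alpha> x) \<beta> = lH \<alpha> (rmH x \<beta>)"
    by (simp add: lH_def shift_def rmH_def)
  show "lH (of_real r) x = rmH x (of_real r)"
    by (simp add: lH_def shift_def rmH_def lmul_of_real HQ_scaleR [OF x] fun_eq_iff)
      (simp add: of_real_def)
  assume y: "y \<in> HQ"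
  show "lH \<alpha> (x + y) = lH \<alpha> x + lH \<alpha> y"
    by (simp add: lH_def shift_def fun_eq_iff)
  show "qip (lH \<alpha> x) y = qip x (lH (qcnj \<alpha>) y)"
    by (rule qip_lH [OF x y])
next
  fix s :: "nat \<Rightarrow> 'a \<Rightarrow> 'a \<Rightarrow> quat"
  assume "\<And>n. s n \<in> HQ" "\<And>e. e > 0 \<Longrightarrow> \<exists>N. \<forall>m\<ge>N. \<forall>n\<ge>N. ip_norm qip (s m - s n) < e"
  then show "\<exists>l\<in>HQ. (\<lambda>n. ip_norm qip (s n - l)) \<longlonglongrightarrow> 0"
    by (rule HQ_complete)
qed

definition rep :: "'a \<Rightarrow> ('a \<Rightarrow> 'a \<Rightarrow> quat) \<Rightarrow> 'a \<Rightarrow> 'a \<Rightarrow> quat"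
  where "rep c = (\<lambda>g\<in>HQ. \<pi> c g)"

lemma rep_adjoint: "adjoint_pair HQ qip (rep c) (rep (star c))"
  by (simp add: adjoint_pair_def rep_def qip_\<pi>)

lemma rep_extensional: "rep c \<in> HQ \<rightarrow>\<^sub>E HQ"
  by (simp add: rep_def \<pi>_closed)

lemma op_adj_rep: "op_adj HQ qip (rep c) = rep (star c)"
  unfolding op_adj_def
proof (rule the_equality)
  show "rep (star c) \<in> HQ \<rightarrow>\<^sub>E HQ \<and> adjoint_pair HQ qip (rep c) (rep (star c))"
    by (simp add: rep_extensional rep_adjoint)
next
  interpret ip: H_inner_product HQ rmH qip by (rule H_inner_product_HQ)
  fix S assume S: "S \<in> HQ \<rightarrow>\<^sub>E HQ \<and> adjoint_pair HQ qip (rep c) S"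
  show "S = rep (star c)"
  proof (rule PiE_ext [where k = HQ and s = "\<lambda>_. HQ"])
    fix y assume y: "y \<in> HQ"
    define T where "T = rep (star c)"
    have mem: "S y \<in> HQ" "T y \<in> HQ"
      using S rep_extensional [of "star c"] y by (auto simp: T_def)
    define x where "x = S y + rmH (T y) (- 1)"
    have x: "x \<in> HQ"
      using mem by (simp add: x_def ip.add_closed ip.rmul_closed)
    have "qip x (S y) = qip x (T y)"
      using S rep_adjoint [of c] x y unfolding adjoint_pair_def T_def by metis
    then have "qip x x = 0"
      using ip.ip_right_linear [OF x mem, of "- 1"] by (simp add: x_def [symmetric])
    then have "x = 0" by (rule ip.ip_definite [OF x])
    then show "S y = rep (star c) y"
      by (simp add: x_def T_def rmH_def fun_eq_iff)
  qed (use S rep_extensional in auto)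
qed

lemma rep_in_LHr: "rep c \<in> LHr HQ rmH qip"
proof -
  interpret ip: right_H_module HQ rmH by (rule right_H_module_HQ)
  have "rep c (x + y) = rep c x + rep c y" if "x \<in> HQ" "y \<in> HQ" for x y
    using that by (simp add: rep_def ip.add_closed \<pi>_def shift_def fun_eq_iff)
  moreover have "rep c (rmH x \<alpha>) = rmH (rep c x) \<alpha>" if "x \<in> HQ" for x \<alpha>
    using that ip.rmul_closed [OF that, of \<alpha>] by (simp add: rep_def \<pi>_def shift_def)
      (simp add: rmH_def)
  ultimately show ?thesis
    unfolding LHr_def by (simp add: rep_extensional) (rule bexI, rule rep_adjoint, rule rep_extensional)
qed

lemma H_star_hom_rep: "H_star_hom lmul rmul star HQ lH rmH qip rep"
  unfolding H_star_hom_def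
proof (intro conjI allI)
  fix a b \<alpha>
  show "rep a \<in> LHr HQ rmH qip" by (rule rep_in_LHr)
  show "rep (a + b) = op_add HQ (rep a) (rep b)"
    by (auto simp: rep_def op_add_def \<pi>_def shift_def star_add distrib_right HQ_add fun_eq_iff)
  show "rep (lmul \<alpha> a) = op_lmul HQ lH \<alpha> (rep a)"
    by (rule extensionalityI [of _ HQ])
      (auto simp: rep_def op_lmul_def Theta_def compose_def \<pi>_closed,
       simp add: \<pi>_def lH_def shift_def star_lmul rmul_times)
  show "rep (rmul a \<alpha>) = op_rmul HQ lH (rep a) \<alpha>"
    by (rule extensionalityI [of _ HQ])
      (auto simp: rep_def op_rmul_def Theta_def compose_def lH_closed,
       simp add: \<pi>_def lH_def shift_def star_rmul lmul_times)
  show "rep (a * b) = compose HQ (rep a) (rep b)"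
    by (rule extensionalityI [of _ HQ])
      (auto simp: rep_def compose_def \<pi>_closed,
       simp add: \<pi>_def shift_def star_times mult.assoc)
  show "rep (star a) = op_adj HQ qip (rep a)"
    by (simp add: op_adj_rep)
qed

abbreviation opn :: "'a \<Rightarrow> real"
  where "opn c \<equiv> op_norm HQ qip (rep c)"

abbreviation nrm :: "('a \<Rightarrow> 'a \<Rightarrow> quat) \<Rightarrow> real"
  where "nrm g \<equiv> ip_norm qip g"

lemma nrm_nonneg: "0 \<le> nrm g"
  by (simp add: ip_norm_def)

lemma zero_in_HQ: "0 \<in> HQ" and nrm_zero: "nrm 0 = 0"
proof -
  show *: "0 \<in> HQ"
    using right_H_module_HQ by (rule right_H_module.zero_closed)
  show "nrm 0 = 0"
    using ip_norm_qip [OF *] by (simp add: cp_zero)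
qed

lemma nrm_rmH_of_real:
  assumes "g \<in> HQ"
  shows "nrm (rmH g (of_real r)) = \<bar>r\<bar> * nrm g"
proof -
  have mem: "rmH g (of_real r) \<in> HQ"
    using right_H_module_HQ assms by (rule right_H_module.rmul_closed)
  have "(nrm (rmH g (of_real r)))\<^sup>2 = (\<bar>r\<bar> * nrm g)\<^sup>2"
    using HQ_D [OF assms]
    unfolding ip_norm_qip [OF mem] power_mult_distrib ip_norm_qip [OF assms]
    by (simp add: cp_rmH of_real_quat Q_cmult algebra_simps)
  then show ?thesis
    by (simp add: nrm_nonneg)
qed

lemma opn_leI:
  assumes "\<And>g. g \<in> HQ \<Longrightarrow> nrm (\<pi> c g) \<le> C * nrm g" "C \<ge> 0"
  shows "opn c \<le> C"
  unfolding op_norm_def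
proof (rule cSUP_least)
  show "{y \<in> HQ. nrm y \<le> 1} \<noteq> {}"
    using zero_in_HQ nrm_zero by auto
  fix g assume g: "g \<in> {y \<in> HQ. nrm y \<le> 1}"
  then have "nrm (\<pi> c g) \<le> C * nrm g" using assms(1) by simp
  also have "\<dots> \<le> C * 1" using g assms(2) by (intro mult_left_mono) auto
  finally show "nrm (rep c g) \<le> C" using g by (simp add: rep_def)
qed

lemma opn_le_norm: "opn c \<le> norm c"
  by (rule opn_leI) (simp_all add: ip_norm_\<pi>)

lemma nrm_le_opn_of_unit:
  assumes "g \<in> HQ" "nrm g \<le> 1"
  shows "nrm (\<pi> c g) \<le> opn c"
proof -
  have "nrm (rep c g) \<le> opn c"
    unfolding op_norm_def
  proof (rule cSUP_upper)
    have "nrm (rep c y) \<le> norm c" if "y \<in> HQ" "nrm y \<le> 1" for y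
      using ip_norm_\<pi> [OF that(1), of c] mult_left_mono [OF that(2) norm_ge_zero [of c]] that(1)
      by (simp add: rep_def)
    then show "bdd_above ((\<lambda>y. nrm (rep c y)) ` {y \<in> HQ. nrm y \<le> 1})"
      by (auto intro: bdd_aboveI [of _ "norm c"])
  qed (use assms in simp)
  then show ?thesis using assms(1) by (simp add: rep_def)
qed

lemma opn_nonneg: "0 \<le> opn c"
  using nrm_le_opn_of_unit [OF zero_in_HQ] nrm_zero nrm_nonneg by (metis order_trans zero_le_one)

lemma nrm_le_opn:
  assumes "g \<in> HQ"
  shows "nrm (\<pi> c g) \<le> opn c * nrm g"
proof (cases "nrm g = 0")
  case True
  then show ?thesis
    using ip_norm_\<pi> [OF assms, of c] by simp
next
  case False
  define r where "r = inverse (nrm g)"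
  have r: "r > 0" using False nrm_nonneg [of g] by (simp add: r_def)
  have mem: "rmH g (of_real r) \<in> HQ"
    using right_H_module_HQ assms by (rule right_H_module.rmul_closed)
  have "nrm (\<pi> c (rmH g (of_real r))) \<le> opn c"
    using False r by (intro nrm_le_opn_of_unit mem) (simp add: nrm_rmH_of_real [OF assms] r_def)
  moreover have "\<pi> c (rmH g (of_real r)) = rmH (\<pi> c g) (of_real r)"
    by (simp add: \<pi>_def shift_def rmH_def)
  ultimately have "r * nrm (\<pi> c g) \<le> opn c"
    using r by (simp add: nrm_rmH_of_real \<pi>_closed [OF assms])
  then show ?thesis
    using False r by (simp add: r_def field_simps)
qed

lemma opn_times: "opn (c * d) \<le> opn c * opn d"
proof (rule opn_leI)
  fix g assume g: "g \<in> HQ"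
  have "\<pi> (c * d) g = \<pi> c (\<pi> d g)"
    by (simp add: \<pi>_def shift_def star_times mult.assoc)
  then have "nrm (\<pi> (c * d) g) \<le> opn c * nrm (\<pi> d g)"
    using nrm_le_opn [OF \<pi>_closed [OF g]] by simp
  also have "\<dots> \<le> opn c * (opn d * nrm g)"
    using g by (intro mult_left_mono nrm_le_opn opn_nonneg)
  finally show "nrm (\<pi> (c * d) g) \<le> opn c * opn d * nrm g"
    by (simp add: mult.assoc)
qed (simp add: opn_nonneg)

text \<open>
  There may be no unit, so the point \<open>(c, star c)\<close> provides the test vector. With \<open>h = c * star c\<close> its
  squared norm is \<open>\<Phi> c h \<le> norm h\<close>, and that of its image is \<open>\<Phi> c (h * h) \<ge> (norm h)\<^sup>2 / 4\<close>.
\<close>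

lemma half_norm_le_opn: "norm c / 2 \<le> opn c"
proof (cases "c = 0")
  case False
  define h where "h = c * star c"
  have h: "star h = h" "norm h = (norm c)\<^sup>2" by (simp_all add: h_def star_times star_star Bstar_identity')
  have hp: "norm h > 0" using False h by simp
  have \<pi>k: "\<pi> c (kq c (star c)) = kq c h"
    by (simp add: \<pi>_def shift_def kq_def gk_def h_def star_times star_star mult.assoc fun_eq_iff)
  have "norm h * (norm h / 4) \<le> \<Phi> c (h * h)"
    using \<Phi>_large [of c] by (simp add: h_def power2_eq_square)
  also have "\<dots> = (nrm (kq c h))\<^sup>2"
    by (simp add: ip_norm_kq gk_def h)
  also have "\<dots> \<le> (opn c * nrm (kq c (star c)))\<^sup>2"
    using nrm_le_opn [OF kq_HQ [of c "star c"], of c]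
    by (intro power_mono) (simp_all add: \<pi>k nrm_nonneg)
  also have "\<dots> = (opn c)\<^sup>2 * \<Phi> c h"
    by (simp add: power_mult_distrib ip_norm_kq gk_def star_star h_def)
  also have "\<dots> \<le> (opn c)\<^sup>2 * norm h"
    using \<Phi>_le [of c h] by (intro mult_left_mono) auto
  finally have "norm h * (norm h / 4) \<le> norm h * (opn c)\<^sup>2"
    by (simp only: mult.commute)
  then have "norm h / 4 \<le> (opn c)\<^sup>2"
    using hp by (simp only: mult_le_cancel_left_pos)
  then have "(norm c / 2)\<^sup>2 \<le> (opn c)\<^sup>2"
    by (simp add: h(2) power_divide)
  then show ?thesis
    by (rule power2_le_imp_le [OF _ opn_nonneg])
qed (simp add: opn_nonneg)

text \<open>
  For self-adjoint \<open>h\<close> the norm of \<open>h ^ 2 ^ n\<close> is exactly \<open>norm h ^ 2 ^ n\<close>, so the factor two is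
  removed by taking roots. The general case follows from \<open>norm (star c * c) = (norm c)\<^sup>2\<close>.
\<close>

lemma norm_le_opn: "norm c \<le> opn c"
proof -
  have power: "norm h ^ 2 ^ n \<le> 2 * opn h ^ 2 ^ n" if "star h = h" for h n
    using that
  proof (induction n arbitrary: h)
    case 0
    then show ?case using half_norm_le_opn [of h] by simp
  next
    case (Suc n)
    have "norm h ^ 2 ^ Suc n = norm (h * h) ^ 2 ^ n"
      using Bstar_identity [of h] Suc.prems by (simp add: power_mult)
    also have "\<dots> \<le> 2 * opn (h * h) ^ 2 ^ n"
      using Suc.prems by (intro Suc.IH) (simp add: star_times)
    also have "\<dots> \<le> 2 * (opn h * opn h) ^ 2 ^ n"
      by (intro mult_left_mono power_mono opn_times opn_nonneg) simp
    finally show ?case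
      by (simp add: power_mult power2_eq_square)
  qed
  have sa: "norm h \<le> opn h" if "star h = h" for h
  proof (rule ccontr)
    assume *: "\<not> ?thesis"
    have "opn h > 0"
    proof (rule ccontr)
      assume "\<not> opn h > 0"
      then have "opn h = 0" using opn_nonneg [of h] by simp
      then show False using * half_norm_le_opn [of h] by simp
    qed
    define r where "r = norm h / opn h"
    have r: "r > 1" using * \<open>opn h > 0\<close> by (simp add: r_def)
    obtain n where "2 < r ^ n"
      using real_arch_pow [OF r] by blast
    also have "\<dots> \<le> r ^ 2 ^ n"
      using r by (intro power_increasing) (auto simp: less_imp_le)
    also have "\<dots> \<le> 2"
      using power [OF that, of n] \<open>opn h > 0\<close> by (simp add: r_def power_divide field_simps)
    finally show False by simp
  qed
  have "(norm c)\<^sup>2 \<le> opn (star c * c)"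
    using sa [of "star c * c"] by (simp add: Bstar_identity star_times star_star)
  also have "\<dots> \<le> opn (star c) * opn c"
    by (rule opn_times)
  also have "\<dots> \<le> norm c * opn c"
    using mult_right_mono [OF opn_le_norm [of "star c"] opn_nonneg [of c]] by simp
  finally show ?thesis
    using opn_nonneg [of c] by (cases "c = 0") (auto simp: power2_eq_square)
qed

theorem isometric_H_star_hom_rep: "isometric_H_star_hom lmul rmul star HQ lH rmH qip rep"
  unfolding isometric_H_star_hom_def
  using H_star_hom_rep opn_le_norm norm_le_opn by (auto intro: antisym)

end

lemma (in H_Bstar_algebra) GNS_exists: "\<exists>\<Phi>. GNS lmul rmul star \<Phi>"
proof -
  define P where "P a f \<longleftrightarrow> linear f \<and> (\<forall>z. \<bar>f z\<bar> \<le> norm z) \<and> (\<forall>z. f (star z) = f z) \<and>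
      (\<forall>z. 0 \<le> f (star z * z)) \<and> (norm (a * star a))\<^sup>2 / 4 \<le> f (a * star a * (a * star a))"
    for a and f :: "'a \<Rightarrow> real"
  have "\<exists>f. P a f" for a
  proof (cases "a * star a = 0")
    case True
    have "linear (\<lambda>z::'a. 0::real)" by (intro linearI) auto
    then have "P a (\<lambda>z. 0)" using True by (simp add: P_def)
    then show ?thesis by (rule exI [of "P a"])
  next
    case False
    obtain f where "linear f" "\<And>z. \<bar>f z\<bar> \<le> norm z" "\<And>z. f (star z) = f z"
      "\<And>z. 0 \<le> f (star z * z)"
      "(norm (a * star a))\<^sup>2 / 4 \<le> f (star (a * star a) * (a * star a))"
      using positive_functional_exists [OF False] by blast
    then have "P a f" by (simp add: P_def star_times star_star)
    then show ?thesis by (rule exI [of "P a"])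
  qed
  then have "\<forall>a. \<exists>f. P a f" ..
  from choice [OF this] obtain \<Phi> where \<Phi>: "\<forall>a. P a (\<Phi> a)" ..
  have "GNS lmul rmul star \<Phi>"
    by (intro GNS.intro GNS_axioms.intro H_Bstar_algebra_axioms) (use \<Phi> in \<open>simp_all add: P_def\<close>)
  then show ?thesis by (rule exI [of "GNS lmul rmul star"])
qed

theorem theorem4p5:
  fixes lmul :: "quat \<Rightarrow> 'a::{real_normed_algebra, banach} \<Rightarrow> 'a"
    and rmul :: "'a \<Rightarrow> quat \<Rightarrow> 'a"
    and star :: "'a \<Rightarrow> 'a"
  assumes "H_Bstar_algebra lmul rmul star"
  shows "\<exists>(H :: ('a \<Rightarrow> 'a \<Rightarrow> quat) set) lH rH ip \<phi>.
    Hilbert_H_bimodule H lH rH ip \<and>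
    isometric_H_star_hom lmul rmul star H lH rH ip \<phi>"
proof -
  obtain \<Phi> where "GNS lmul rmul star \<Phi>"
    using H_Bstar_algebra.GNS_exists [OF assms] by blast
  then interpret GNS lmul rmul star \<Phi> .
  show ?thesis
    using Hilbert_H_bimodule_HQ isometric_H_star_hom_rep by blast
qed

end
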